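(* Let $T_{\mathrm e}$ be a random variable with exponential law of parameter $4$, that is, with density $4e^{-4t}$ on $t\ge0$ with respect to the Lebesgue measure, and let $T_{\mathrm i}$ be a random variable independent of $T_{\mathrm e}$. Then the following holds. (i) If the distribution of $T_{\mathrm i}$ is uniform on $[0,\theta]$ with $\theta>0$, the distribution of $(T_{\mathrm e},T_{\mathrm i})$ is tempered but not tame. (ii) If the distribution of $T_{\mathrm i}$ has density $\theta x^{\theta-1}$ on the interval $[0,1]$, for a given $\theta\in(0,1)$, the distribution of $(T_{\mathrm e},T_{\mathrm i})$ is tempered but not tame. (iii) If the distribution of $T_{\mathrm i}$ has density $\log(1/x)$ on the interval $[0,1]$, the distribution of $(T_{\mathrm e},T_{\mathrm i})$ is not tempered. (iv) If the distribution of $T_{\mathrm i}$ has density $4x\log(1/x)$ on the interval $[0,1]$, the distribution of $(T_{\mathrm e},T_{\mathrm i})$ is not tempered.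
   Context: **Tame.** Every tame prior (in the sense of Steel and Matsen) has a smooth joint probability density on $[0,\infty)^2$ which is bounded and everywhere non zero; "not tame" here means that no such joint density exists. **Tempered.** For $s\in[0,1]$ and $z\in[0,3]$ let $$G(z,s)=\mathbb P\big(e^{-4T_{\mathrm e}}(1-e^{-4T_{\mathrm i}})\le s\,\big|\,e^{-4T_{\mathrm e}}(1+2e^{-4T_{\mathrm i}})=z\big)$$ (a version of the conditional distribution function). For $t>0$ let $4q_0=1+3e^{-4t}$, and for $n\ge1$ let $Q_n(t)=\mathbb P(T_{\mathrm i}\le 1/n,\ t\le T_{\mathrm e}\le t+1/n)$. The law of $(T_{\mathrm e},T_{\mathrm i})$ is tempered if (for a suitable version of $G$): (1) for every $t>0$ there exist $s_0\in(0,1]$, an interval $I_t\subset(0,3)$ which is a neighborhood of $4q_0-1$, an integer $k\ge1$, positive numbers $\alpha,\kappa$, real numbers $0=\varepsilon_0<\varepsilon_1<\dots<\varepsilon_{k-1}\le 2<\varepsilon_k$, and bounded functions $F_0,\dots,F_{k-1}$ on $I_t$, such that for all $s\in[0,s_0]$ and $z\in I_t$, $$\Big|G(z,s)-\sum_{i=0}^{k-1}F_i(z)s^{\alpha+\varepsilon_i}\Big|\le\kappa s^{\alpha+\varepsilon_k};$$ (2) for every $t>0$, $n^{-1}\log Q_n(t)\to0$ as $n\to\infty$. *)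

theory Defs
  imports "HOL-Probability.Probability"
begin

text \<open>
  Laws of pairs $(T_{\mathrm e}, T_{\mathrm i})$ are measures on \<^typ>\<open>real \<times> real\<close>;
  the first coordinate is the exterior time, the second one the interior time.
\<close>

definition Z_stat :: "real \<times> real \<Rightarrow> real" where
  "Z_stat = (\<lambda>(te, ti). exp (- 4 * te) * (1 + 2 * exp (- 4 * ti)))"

definition S_stat :: "real \<times> real \<Rightarrow> real" where
  "S_stat = (\<lambda>(te, ti). exp (- 4 * te) * (1 - exp (- 4 * ti)))"

text \<open>
  \<open>G z s\<close> is a version of the probability that $S \le s$ given $Z = z$, for $z \in [0,3]$ and
  $s \in [0,1]$.  For nonnegative times, $Z$ and $S$ take their values in $[0,3]$ and $[0,1]$,
  so that \<open>G z\<close> is a distribution function on $[0,1]$ (with \<open>G z 0 > 0\<close> allowed); the values of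
  \<open>G\<close> elsewhere are irrelevant.
\<close>

definition cond_cdf_version :: "(real \<times> real) measure \<Rightarrow> (real \<Rightarrow> real \<Rightarrow> real) \<Rightarrow> bool" where
  "cond_cdf_version \<mu> G \<longleftrightarrow>
     (\<forall>z\<in>{0..3}. 0 \<le> G z 0 \<and> G z 1 = 1 \<and> mono_on {0..1} (G z) \<and>
        (\<forall>s\<in>{0..<1}. continuous (at_right s) (G z))) \<and>
     (\<forall>s\<in>{0..1}. (\<lambda>z. G z s) \<in> borel_measurable (restrict_space borel {0..3}) \<and>
        (AE x in \<mu>. G (Z_stat x) s =
           real_cond_exp \<mu> (vimage_algebra (space \<mu>) Z_stat borel) (indicator {x. S_stat x \<le> s}) x))"

definition q0 :: "real \<Rightarrow> real" where
  "q0 t = (1 + 3 * exp (- 4 * t)) / 4"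

definition small_s_expansion :: "(real \<Rightarrow> real \<Rightarrow> real) \<Rightarrow> real \<Rightarrow> bool" where
  "small_s_expansion G t \<longleftrightarrow>
     (\<exists>(s0::real) (I::real set) (k::nat) (\<alpha>::real) (\<kappa>::real) (\<epsilon>::nat \<Rightarrow> real) (F::nat \<Rightarrow> real \<Rightarrow> real).
        0 < s0 \<and> s0 \<le> 1 \<and>
        is_interval I \<and> I \<subseteq> {0<..<3} \<and> 4 * q0 t - 1 \<in> interior I \<and>
        1 \<le> k \<and> 0 < \<alpha> \<and> 0 < \<kappa> \<and>
        \<epsilon> 0 = 0 \<and> (\<forall>i<k. \<epsilon> i < \<epsilon> (Suc i)) \<and> \<epsilon> (k - 1) \<le> 2 \<and> 2 < \<epsilon> k \<and>
        (\<forall>i<k. bounded (F i ` I)) \<and>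
        (\<forall>s\<in>{0..s0}. \<forall>z\<in>I.
           \<bar>G z s - (\<Sum>i<k. F i z * s powr (\<alpha> + \<epsilon> i))\<bar> \<le> \<kappa> * s powr (\<alpha> + \<epsilon> k)))"

definition Q_prob :: "(real \<times> real) measure \<Rightarrow> nat \<Rightarrow> real \<Rightarrow> real" where
  "Q_prob \<mu> n t = measure \<mu> {(te, ti). ti \<le> 1 / real n \<and> t \<le> te \<and> te \<le> t + 1 / real n}"

text \<open>
  Since \<open>ln 0 = 0\<close> in HOL, the positivity of $Q_n(t)$ for large $n$, implicit in
  $n^{-1} \log Q_n(t) \to 0$, is spelled out.
\<close>

definition tempered :: "(real \<times> real) measure \<Rightarrow> bool" where
  "tempered \<mu> \<longleftrightarrow>
     (\<exists>G. cond_cdf_version \<mu> G \<and> (\<forall>t>0. small_s_expansion G t)) \<and>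
     (\<forall>t>0. (\<forall>\<^sub>F n in sequentially. 0 < Q_prob \<mu> n t) \<and>
            (\<lambda>n. ln (Q_prob \<mu> n t) / real n) \<longlonglongrightarrow> 0)"

fun C_k_on :: "nat \<Rightarrow> ('a::euclidean_space) set \<Rightarrow> ('a \<Rightarrow> real) \<Rightarrow> bool" where
  "C_k_on 0 U f \<longleftrightarrow> continuous_on U f"
| "C_k_on (Suc k) U f \<longleftrightarrow>
     (\<exists>f'. (\<forall>x\<in>U. (f has_derivative f' x) (at x)) \<and> (\<forall>v. C_k_on k U (\<lambda>x. f' x v)))"

text \<open>
  As usual, a function is smooth on a set that need not be open if it extends to a $C^\infty$
  function on an open neighbourhood of that set.
\<close>

definition smooth_on_set :: "('a::euclidean_space) set \<Rightarrow> ('a \<Rightarrow> real) \<Rightarrow> bool" where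
  "smooth_on_set A f \<longleftrightarrow>
     (\<exists>U g. open U \<and> A \<subseteq> U \<and> (\<forall>k. C_k_on k U g) \<and> (\<forall>x\<in>A. g x = f x))"

definition quadrant :: "(real \<times> real) set" where
  "quadrant = {0..} \<times> {0..}"

definition tame :: "(real \<times> real) measure \<Rightarrow> bool" where
  "tame \<mu> \<longleftrightarrow>
     (\<exists>f. \<mu> = density lborel (\<lambda>x. ennreal (f x) * indicator quadrant x) \<and>
          smooth_on_set quadrant f \<and> bounded (f ` quadrant) \<and>
          (\<forall>x\<in>quadrant. 0 \<le> f x \<and> f x \<noteq> 0))"

end

theory Submission
  imports Defs "HOL-Real_Asymp.Real_Asymp"
begin

text \<open>
  Put \<open>X = exp (- 4 te)\<close> and \<open>y = exp (- 4 ti)\<close>. Since the exterior time is exponential with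
  parameter 4, \<open>X\<close> is uniform on \<open>[0, 1]\<close>, and \<open>Z = X (1 + 2 y)\<close>, while \<open>S / Z = (1 - y) / (1 + 2 y)\<close>
  depends on the interior time only. So, given \<open>ti\<close>, the variable \<open>Z\<close> is uniform on \<open>[0, 1 + 2 y]\<close>,
  and given \<open>Z = z\<close> the event \<open>S \<le> s\<close> is a condition on \<open>ti\<close> alone. With \<open>\<nu>\<close> the law of \<open>ti\<close>,
  Bayes' formula gives the conditional distribution function as the quotient of two integrals of
  \<open>1 / (1 + 2 y)\<close> against \<open>\<nu>\<close>, one over \<open>z \<le> 1 + 2 y \<and> z (1 - y) \<le> s (1 + 2 y)\<close> and one over
  \<open>z \<le> 1 + 2 y\<close> (lemma \<open>cond_cdf_version_cond_cdf\<close>).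

  For \<open>0 < z < 3\<close> and small \<open>s\<close> the second inequality implies the first one. Since
  \<open>(1 - y) / (1 + 2 y) \<le> u\<close> means \<open>ti \<le> level u\<close>, the conditional distribution function
  is \<open>\<Phi> (s / z) / C z\<close>, where \<open>\<Phi> u\<close> is the integral of \<open>1 / (1 + 2 y)\<close> over \<open>ti \<le> level u\<close>
  (the function \<open>profile\<close>) and \<open>C\<close> is the density of \<open>Z\<close> (lemma \<open>cond_cdf_eq_profile\<close>). Hence the
  expansion required of a tempered law is an expansion at 0 of the function \<open>\<Phi>\<close> of one variable. If
  \<open>\<nu>\<close> has a density \<open>h\<close>, the factors coming from the change of variables cancel almost completely:
  \<open>\<Phi>' u = h (level u) / (4 (1 - u))\<close> (lemma \<open>DERIV_profile\<close>), and \<open>level u\<close> is analytic at 0 with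
  \<open>level u = 3 u / 4 + ...\<close>.

  \<^item> If \<open>h x = c x powr (\<theta> - 1)\<close> near 0 with \<open>0 < \<theta> \<le> 1\<close>, which covers the uniform law and the laws
    of the second family, \<open>\<Phi>' u\<close> is \<open>u powr (\<theta> - 1)\<close> times an analytic function. Hence \<open>\<Phi>\<close> has
    an expansion with exponents \<open>\<theta>, \<theta> + 1, \<theta> + 2\<close> and error \<open>O(u powr (\<theta> + 3))\<close>
    (lemma \<open>profile_expansion\<close>). Moreover \<open>Q\<^sub>n(t)\<close> is at least of order \<open>1 / n\<^sup>2\<close>. So the law
    is tempered. It is not tame, since a tame law charges every box in the quadrant, while here
    the interior time is bounded.

  \<^item> If \<open>h x = c x ^ (n - 1) log (1 / x)\<close> near 0 with \<open>n = 1\<close> or \<open>n = 2\<close>, then \<open>\<Phi> u\<close> is asymptotic to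
    a nonzero multiple of \<open>u ^ n log (1 / u)\<close> (lemma \<open>profile_asymp_log\<close>). No finite sum of powers
    with an error smaller than \<open>u\<^sup>2\<close> behaves like this (lemma \<open>power_log_has_no_expansion\<close>).
    Another version of the conditional distribution function does not help: right continuity
    makes any two versions agree at all \<open>s < 1\<close> for almost every value of \<open>Z\<close>, and \<open>Z\<close> falls in
    every neighbourhood of \<open>3 exp (- 4 t)\<close> with positive probability.
\<close>

section \<open>The statistics in terms of a uniform variable\<close>

text \<open>
  For a given interior time \<open>x\<close>, the statistic \<open>Z\<close> is uniform on \<open>[0, span_Z x]\<close> and
  the quotient \<open>S / Z\<close> is the constant \<open>ratio_SZ x\<close>.
\<close>

definition span_Z :: "real \<Rightarrow> real" where
  "span_Z x = 1 + 2 * exp (- 4 * x)"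

definition ratio_SZ :: "real \<Rightarrow> real" where
  "ratio_SZ x = (1 - exp (- 4 * x)) / span_Z x"

lemma span_Z_gt_1: "1 < span_Z x"
  by (simp add: span_Z_def)

lemma span_Z_pos [simp]: "0 < span_Z x" "span_Z x \<noteq> 0"
  using span_Z_gt_1[of x] by auto

lemma span_Z_measurable [measurable]: "span_Z \<in> borel_measurable borel"
  unfolding span_Z_def by measurable

lemma ratio_SZ_measurable [measurable]: "ratio_SZ \<in> borel_measurable borel"
  unfolding ratio_SZ_def by measurable

lemma Z_stat_measurable [measurable]: "Z_stat \<in> borel_measurable (borel \<Otimes>\<^sub>M borel)"
  unfolding Z_stat_def by measurable

lemma S_stat_measurable [measurable]: "S_stat \<in> borel_measurable (borel \<Otimes>\<^sub>M borel)"
  unfolding S_stat_def by measurable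

lemma Z_stat_eq_span: "Z_stat (t, x) = exp (- 4 * t) * span_Z x"
  by (simp add: Z_stat_def span_Z_def)

lemma S_stat_eq_ratio: "S_stat (t, x) = Z_stat (t, x) * ratio_SZ x"
  by (simp add: Z_stat_def S_stat_def ratio_SZ_def span_Z_def)
     (metis add_pos_pos exp_gt_zero less_numeral_extra(1,3) mult_pos_pos zero_less_numeral)

abbreviation exterior_law :: "real measure" where
  "exterior_law \<equiv> density lborel (\<lambda>t. ennreal (exponential_density 4 t))"

lemma prob_space_exterior_law: "prob_space exterior_law"
  by (rule prob_space_exponential_density) simp

text \<open>
  The density of the exterior time decreases, so that it is smallest at the right end point.
\<close>

lemma emeasure_exterior_law_ge:
  assumes "0 \<le> t" "0 \<le> \<delta>"
  shows "ennreal (4 * exp (- 4 * (t + \<delta>)) * \<delta>) \<le> emeasure exterior_law {t..t + \<delta>}"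
proof -
  have "ennreal (4 * exp (- 4 * (t + \<delta>)) * \<delta>)
      = (\<integral>\<^sup>+x. ennreal (4 * exp (- 4 * (t + \<delta>))) * indicator {t..t + \<delta>} x \<partial>lborel)"
    using assms by (simp add: nn_integral_cmult ennreal_mult)
  also have "\<dots> \<le> (\<integral>\<^sup>+x. ennreal (exponential_density 4 x) * indicator {t..t + \<delta>} x \<partial>lborel)"
    using assms by (intro nn_integral_mono)
      (auto simp: exponential_density_def split: split_indicator intro!: ennreal_leI)
  also have "\<dots> = emeasure exterior_law {t..t + \<delta>}"
    by (simp add: emeasure_density)
  finally show ?thesis .
qed

text \<open>
  This is where the parameter 4 matters: the probability of \<open>exp (- 4 t) * c \<le> b\<close> is the probability
  that an exponential variable of parameter 4 exceeds \<open>- ln (b / c) / 4\<close>, which is \<open>b / c\<close>.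
\<close>

lemma nn_integral_scaled_exponential:
  assumes [measurable]: "f \<in> borel_measurable borel" and "0 < c"
  shows "(\<integral>\<^sup>+t. f (exp (- 4 * t) * c) \<partial>exterior_law)
       = (\<integral>\<^sup>+z. f z * ennreal (indicator {0..c} z / c) \<partial>lborel)"
proof -
  interpret prob_space exterior_law
    by (rule prob_space_exterior_law)
  let ?X = "\<lambda>t::real. exp (- 4 * t) * c"
  have id: "distributed exterior_law lborel (\<lambda>x. x) (exponential_density 4)"
    unfolding distributed_def by (auto simp: distr_id2)
  have P: "prob {t. ?X t \<le> b} = b / c" if "0 < b" "b \<le> c" for b
  proof -
    \<comment> \<open>The time at which \<open>exp (- 4 * t) * c\<close> has decreased to \<open>b\<close>.\<close>
    define a where "a = - ln (b / c) / 4"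
    have b: "b = exp (- 4 * a) * c"
      using that assms by (simp add: a_def)
    have a: "0 \<le> a"
      using that assms by (simp add: a_def)
    have X: "?X t \<le> b \<longleftrightarrow> a \<le> t" for t
      using assms by (subst b) simp
    have "AE t in exterior_law. t \<in> {t. ?X t \<le> b} \<longleftrightarrow> t \<in> {t. a < t}"
      unfolding X using AE_lborel_singleton[of a] by (auto simp: AE_density)
    then have "prob {t. ?X t \<le> b} = prob {t. a < t}"
      by (intro finite_measure_eq_AE) auto
    also have "\<dots> = exp (- a * 4)"
      using exponential_distributedD_gt[OF id a] by simp
    also have "\<dots> = b / c"
      using assms by (subst b) (simp add: mult.commute)
    finally show ?thesis .
  qed
  have U: "distributed exterior_law lborel ?X (\<lambda>z. indicator {0..c} z / measure lborel {0..c})"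
  proof (rule uniform_distrI_borel_atLeastAtMost)
    fix b :: real assume "0 \<le> b" "b \<le> c"
    moreover have "prob {t. ?X t \<le> 0} = 0"
      using \<open>0 < c\<close> by (simp add: mult_le_0_iff not_le)
    ultimately show "\<P>(t in exterior_law. ?X t \<le> b) = (b - 0) / (c - 0)"
      using P[of b] by (cases "b = 0") auto
  qed (use assms in auto)
  have "(\<integral>\<^sup>+t. f (?X t) \<partial>exterior_law)
      = (\<integral>\<^sup>+z. ennreal (indicator {0..c} z / measure lborel {0..c}) * f z \<partial>lborel)"
    using U assms by (intro distributed_nn_integral[symmetric]) auto
  also have "\<dots> = (\<integral>\<^sup>+z. f z * ennreal (indicator {0..c} z / c) \<partial>lborel)"
    using \<open>0 < c\<close> by (intro nn_integral_cong) (auto simp: mult.commute)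
  finally show ?thesis .
qed

text \<open>
  The joint law of \<open>Z\<close> and the interior time has the density \<open>1 / span_Z x\<close> on \<open>0 \<le> z \<le> span_Z x\<close> with
  respect to the product of Lebesgue measure and the law of the interior time. All
  conditional probabilities below come from this identity.
\<close>

lemma nn_integral_Z_interior:
  assumes \<nu>: "real_distribution \<nu>"
    and f [measurable]: "f \<in> borel_measurable (borel \<Otimes>\<^sub>M borel)"
  shows "(\<integral>\<^sup>+p. f (Z_stat p, snd p) \<partial>(exterior_law \<Otimes>\<^sub>M \<nu>))
       = (\<integral>\<^sup>+z. \<integral>\<^sup>+x. f (z, x) * ennreal (indicator {0..span_Z x} z / span_Z x) \<partial>\<nu> \<partial>lborel)"
proof -
  interpret \<nu>: real_distribution \<nu> by fact
  interpret E: prob_space exterior_law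
    by (rule prob_space_exterior_law)
  interpret P: pair_sigma_finite exterior_law \<nu> ..
  interpret L: pair_sigma_finite lborel \<nu> ..
  note [measurable_cong] = \<nu>.events_eq_borel
  have [measurable]: "(\<lambda>p. f (Z_stat p, snd p)) \<in> borel_measurable (exterior_law \<Otimes>\<^sub>M \<nu>)"
    by measurable
  have "(\<integral>\<^sup>+p. f (Z_stat p, snd p) \<partial>(exterior_law \<Otimes>\<^sub>M \<nu>))
      = (\<integral>\<^sup>+x. \<integral>\<^sup>+t. f (exp (- 4 * t) * span_Z x, x) \<partial>exterior_law \<partial>\<nu>)"
    by (subst P.nn_integral_snd[symmetric]) (auto simp: Z_stat_eq_span)
  also have "\<dots> = (\<integral>\<^sup>+x. \<integral>\<^sup>+z. f (z, x) * ennreal (indicator {0..span_Z x} z / span_Z x) \<partial>lborel \<partial>\<nu>)"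
    by (intro nn_integral_cong nn_integral_scaled_exponential) auto
  also have "\<dots> = (\<integral>\<^sup>+z. \<integral>\<^sup>+x. f (z, x) * ennreal (indicator {0..span_Z x} z / span_Z x) \<partial>\<nu> \<partial>lborel)"
  proof (rule L.Fubini')
    have "Measurable.pred (borel \<Otimes>\<^sub>M borel) (\<lambda>p. 0 \<le> fst p \<and> fst p \<le> span_Z (snd p))"
      by measurable
    then have [measurable]: "(\<lambda>p. indicator {0..span_Z (snd p)} (fst p) :: real) \<in> borel_measurable (borel \<Otimes>\<^sub>M borel)"
      by (simp add: indicator_def)
    show "(\<lambda>(z, x). f (z, x) * ennreal (indicator {0..span_Z x} z / span_Z x))
       \<in> borel_measurable (lborel \<Otimes>\<^sub>M \<nu>)"
      by measurable
  qed
  finally show ?thesis .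
qed

section \<open>An explicit conditional distribution function\<close>

text \<open>
  For \<open>z \<ge> 0\<close>, the number \<open>Z_density \<nu> z\<close> is the density at \<open>z\<close> of the law of \<open>Z\<close>, and
  \<open>Z_density_le \<nu> z s\<close> that of the measure \<open>B \<mapsto> P (Z \<in> B, S \<le> s)\<close>. Their quotient is the conditional
  distribution function. The value 1 where the density of \<open>Z\<close> vanishes (as it may at \<open>z = 3\<close>) keeps it a
  distribution function in \<open>s\<close> for every \<open>z\<close>.
\<close>

definition Z_density :: "real measure \<Rightarrow> real \<Rightarrow> real" where
  "Z_density \<nu> z = (\<integral>x. indicator {z..} (span_Z x) / span_Z x \<partial>\<nu>)"

definition Z_density_le :: "real measure \<Rightarrow> real \<Rightarrow> real \<Rightarrow> real" where
  "Z_density_le \<nu> z s = (\<integral>x. indicator {z..} (span_Z x) * indicator {..s} (z * ratio_SZ x) / span_Z x \<partial>\<nu>)"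

definition cond_cdf :: "real measure \<Rightarrow> real \<Rightarrow> real \<Rightarrow> real" where
  "cond_cdf \<nu> z s = (if Z_density \<nu> z = 0 then 1 else Z_density_le \<nu> z s / Z_density \<nu> z)"

lemma abs_span_Z_ge_1: "1 \<le> \<bar>span_Z x\<bar>" "1 \<le> span_Z x"
  using span_Z_gt_1[of x] by simp_all

context real_distribution
begin

lemma indicator_span_measurable [measurable]:
  "(\<lambda>(z, x). indicator {z..} (span_Z x) :: real) \<in> borel_measurable (borel \<Otimes>\<^sub>M M)"
  "(\<lambda>x. indicator {z..} (span_Z x) :: real) \<in> borel_measurable M"
proof -
  have "Measurable.pred (borel \<Otimes>\<^sub>M borel) (\<lambda>p. fst p \<le> span_Z (snd p))"
    by measurable
  then show *: "(\<lambda>(z, x). indicator {z..} (span_Z x) :: real) \<in> borel_measurable (borel \<Otimes>\<^sub>M M)"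
    by (simp add: indicator_def case_prod_beta)
  show "(\<lambda>x. indicator {z..} (span_Z x) :: real) \<in> borel_measurable M"
    using measurable_compose[OF measurable_Pair1'[of z borel M] *] by simp
qed

lemma integrable_Z_density: "integrable M (\<lambda>x. indicator {z..} (span_Z x) / span_Z x)"
  by (rule integrable_const_bound[of _ 1])
     (auto simp: divide_le_eq abs_mult abs_span_Z_ge_1 split: split_indicator)

lemma integrable_Z_density_le:
  "integrable M (\<lambda>x. indicator {z..} (span_Z x) * indicator {..s} (z * ratio_SZ x) / span_Z x)"
  by (rule integrable_const_bound[of _ 1])
     (auto simp: divide_le_eq abs_mult abs_span_Z_ge_1 split: split_indicator)

lemma Z_density_le_nonneg: "0 \<le> Z_density_le M z s"
  unfolding Z_density_le_def by (intro Bochner_Integration.integral_nonneg) (simp add: less_imp_le)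

lemma Z_density_le_le_Z_density: "Z_density_le M z s \<le> Z_density M z"
  unfolding Z_density_le_def Z_density_def
  by (intro integral_mono integrable_Z_density integrable_Z_density_le)
     (auto simp: divide_right_mono less_imp_le split: split_indicator)

lemma Z_density_nonneg: "0 \<le> Z_density M z"
  using Z_density_le_nonneg Z_density_le_le_Z_density by (rule order_trans)

lemma cond_cdf_times_Z_density: "cond_cdf M z s * Z_density M z = Z_density_le M z s"
  using Z_density_le_nonneg[of z s] Z_density_le_le_Z_density[of z s] by (auto simp: cond_cdf_def)

lemma cond_cdf_nonneg: "0 \<le> cond_cdf M z s"
  using Z_density_le_nonneg[of z s] Z_density_nonneg[of z] by (auto simp: cond_cdf_def)

lemma cond_cdf_le_1: "cond_cdf M z s \<le> 1"
  using Z_density_le_le_Z_density[of z s] Z_density_nonneg[of z] by (auto simp: cond_cdf_def divide_le_eq)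

lemma Z_density_measurable [measurable]: "Z_density M \<in> borel_measurable borel"
  unfolding Z_density_def by measurable

lemma Z_density_le_measurable [measurable]: "(\<lambda>z. Z_density_le M z s) \<in> borel_measurable borel"
  unfolding Z_density_le_def by measurable

lemma cond_cdf_measurable [measurable]: "(\<lambda>z. cond_cdf M z s) \<in> borel_measurable borel"
  unfolding cond_cdf_def by measurable

text \<open>
  As a function of \<open>s\<close>, \<open>Z_density_le\<close> is the cumulative distribution function of a finite measure, the
  image under \<open>x \<mapsto> z * ratio_SZ x\<close> of the law of \<open>x\<close> with weight \<open>1 / span_Z x\<close> on \<open>z \<le> span_Z x\<close>.
\<close>

lemma Z_density_le_mono_right_continuous:
  "mono (Z_density_le M z)" "continuous (at_right s) (Z_density_le M z)"
proof -
  define D where "D = density M (\<lambda>x. ennreal (indicator {z..} (span_Z x) / span_Z x))"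
  define R where "R = distr D borel (\<lambda>x. z * ratio_SZ x)"
  have meas: "(\<lambda>x. z * ratio_SZ x) \<in> D \<rightarrow>\<^sub>M borel"
    unfolding D_def by measurable
  have emeasure_D: "emeasure D A = ennreal (\<integral>x. indicator {z..} (span_Z x) * indicator A x / span_Z x \<partial>M)"
    if [measurable]: "A \<in> sets borel" for A
  proof -
    have "emeasure D A = (\<integral>\<^sup>+x. ennreal (indicator {z..} (span_Z x) * indicator A x / span_Z x) \<partial>M)"
      unfolding D_def by (subst emeasure_density) (auto intro!: nn_integral_cong split: split_indicator)
    also have "\<dots> = ennreal (\<integral>x. indicator {z..} (span_Z x) * indicator A x / span_Z x \<partial>M)"
      by (intro nn_integral_eq_integral integrable_const_bound[of _ 1])
         (auto simp: divide_le_eq abs_mult abs_span_Z_ge_1 less_imp_le split: split_indicator)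
    finally show ?thesis .
  qed
  have "finite_measure R"
  proof
    have "emeasure R (space R) = emeasure D UNIV"
      using meas by (auto simp: R_def emeasure_distr D_def)
    then show "emeasure R (space R) \<noteq> \<infinity>"
      using emeasure_D[of UNIV] by simp
  qed
  then interpret R: finite_borel_measure R
    by (intro finite_borel_measure.intro finite_borel_measure_axioms.intro) (auto simp: R_def)
  have "emeasure R {..s} = ennreal (Z_density_le M z s)" for s
  proof -
    have "emeasure R {..s} = emeasure D {x. z * ratio_SZ x \<le> s}"
      using meas by (auto simp: R_def emeasure_distr D_def intro!: arg_cong2[where f = emeasure])
    also have "\<dots> = ennreal (Z_density_le M z s)"
      by (subst emeasure_D) (auto simp: Z_density_le_def indicator_def)
    finally show ?thesis .
  qed
  then have "cdf R s = Z_density_le M z s" for s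
    by (simp add: cdf_def measure_def Z_density_le_nonneg)
  then have "Z_density_le M z = cdf R"
    by auto
  then show "mono (Z_density_le M z)" "continuous (at_right s) (Z_density_le M z)"
    using R.cdf_nondecreasing R.cdf_is_right_cont by (auto simp: mono_def)
qed

lemma cond_cdf_mono: "mono (cond_cdf M z)"
  using Z_density_le_mono_right_continuous(1)[of z] Z_density_nonneg[of z]
  by (auto simp: cond_cdf_def mono_def intro!: divide_right_mono)

lemma cond_cdf_right_continuous: "continuous (at_right s) (cond_cdf M z)"
proof (cases "Z_density M z = 0")
  case False
  then show ?thesis
    using Z_density_le_mono_right_continuous(2)[of s z] unfolding cond_cdf_def
    by (auto intro!: continuous_intros)
next
  case True
  then have "cond_cdf M z = (\<lambda>s. 1)"
    by (simp add: cond_cdf_def fun_eq_iff)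
  then show ?thesis
    by simp
qed

text \<open>
  At \<open>s = 1\<close> the condition on \<open>S\<close> is void: \<open>S \<le> 1\<close> whenever \<open>Z\<close> is at most \<open>span_Z x\<close>.
\<close>

lemma cond_cdf_at_1:
  assumes "0 \<le> z"
  shows "cond_cdf M z 1 = 1"
proof -
  have "z * ratio_SZ x \<le> 1" if "z \<le> span_Z x" for x
  proof (cases "ratio_SZ x \<le> 0")
    case True
    then show ?thesis using assms mult_nonneg_nonpos[of z "ratio_SZ x"] by simp
  next
    case False
    then have "z * ratio_SZ x \<le> span_Z x * ratio_SZ x"
      using that by (intro mult_right_mono) auto
    also have "\<dots> \<le> 1"
      by (simp add: ratio_SZ_def)
    finally show ?thesis .
  qed
  then have "Z_density_le M z 1 = Z_density M z"
    unfolding Z_density_le_def Z_density_def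
    by (intro Bochner_Integration.integral_cong) (auto split: split_indicator)
  then show ?thesis
    by (simp add: cond_cdf_def)
qed

text \<open>
  The next two lemmas compute the two sides of the defining identity of conditional
  probabilities. They agree because the conditional distribution function times
  \<open>Z_density\<close> is \<open>Z_density_le\<close>.
\<close>

lemma nn_integral_indicator_Z_times:
  assumes [measurable]: "B \<in> sets borel" "g \<in> borel_measurable borel" and g: "\<And>z. 0 \<le> g z"
  shows "(\<integral>\<^sup>+p. ennreal (indicator B (Z_stat p) * g (Z_stat p)) \<partial>(exterior_law \<Otimes>\<^sub>M M))
       = (\<integral>\<^sup>+z. ennreal (indicator (B \<inter> {0..}) z * g z * Z_density M z) \<partial>lborel)"
proof -
  have "(\<integral>\<^sup>+p. ennreal (indicator B (Z_stat p) * g (Z_stat p)) \<partial>(exterior_law \<Otimes>\<^sub>M M))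
      = (\<integral>\<^sup>+z. \<integral>\<^sup>+x. ennreal (indicator B z * g z) * ennreal (indicator {0..span_Z x} z / span_Z x) \<partial>M \<partial>lborel)"
    using nn_integral_Z_interior[OF real_distribution_axioms, of "\<lambda>p. ennreal (indicator B (fst p) * g (fst p))"]
    by simp
  also have "\<dots> = (\<integral>\<^sup>+z. ennreal (indicator (B \<inter> {0..}) z * g z * Z_density M z) \<partial>lborel)"
  proof (intro nn_integral_cong)
    fix z :: real
    have "(\<integral>\<^sup>+x. ennreal (indicator B z * g z) * ennreal (indicator {0..span_Z x} z / span_Z x) \<partial>M)
        = (\<integral>\<^sup>+x. ennreal (indicator (B \<inter> {0..}) z * g z * (indicator {z..} (span_Z x) / span_Z x)) \<partial>M)"
      using g by (intro nn_integral_cong) (auto simp: ennreal_mult[symmetric] split: split_indicator)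
    also have "\<dots> = ennreal (indicator (B \<inter> {0..}) z * g z * Z_density M z)"
      unfolding Z_density_def using g
      by (subst nn_integral_eq_integral[OF integrable_mult_right[OF integrable_Z_density]])
         (simp_all add: less_imp_le del: times_divide_eq_right)
    finally show "(\<integral>\<^sup>+x. ennreal (indicator B z * g z) * ennreal (indicator {0..span_Z x} z / span_Z x) \<partial>M)
        = ennreal (indicator (B \<inter> {0..}) z * g z * Z_density M z)" .
  qed
  finally show ?thesis .
qed

lemma nn_integral_indicator_Z_S:
  assumes [measurable]: "B \<in> sets borel"
  shows "(\<integral>\<^sup>+p. ennreal (indicator B (Z_stat p) * indicator {p. S_stat p \<le> s} p) \<partial>(exterior_law \<Otimes>\<^sub>M M))
       = (\<integral>\<^sup>+z. ennreal (indicator (B \<inter> {0..}) z * Z_density_le M z s) \<partial>lborel)"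
proof -
  have "(\<integral>\<^sup>+p. ennreal (indicator B (Z_stat p) * indicator {p. S_stat p \<le> s} p) \<partial>(exterior_law \<Otimes>\<^sub>M M))
      = (\<integral>\<^sup>+p. ennreal (indicator B (Z_stat p) * indicator {..s} (Z_stat p * ratio_SZ (snd p))) \<partial>(exterior_law \<Otimes>\<^sub>M M))"
    by (intro nn_integral_cong) (auto simp: S_stat_eq_ratio split: split_indicator)
  also have "\<dots> = (\<integral>\<^sup>+z. \<integral>\<^sup>+x. ennreal (indicator B z * indicator {..s} (z * ratio_SZ x)) * ennreal (indicator {0..span_Z x} z / span_Z x) \<partial>M \<partial>lborel)"
    using nn_integral_Z_interior[OF real_distribution_axioms, of "\<lambda>p. ennreal (indicator B (fst p) * indicator {..s} (fst p * ratio_SZ (snd p)))"]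
    by simp
  also have "\<dots> = (\<integral>\<^sup>+z. ennreal (indicator (B \<inter> {0..}) z * Z_density_le M z s) \<partial>lborel)"
  proof (intro nn_integral_cong)
    fix z :: real
    have "(\<integral>\<^sup>+x. ennreal (indicator B z * indicator {..s} (z * ratio_SZ x)) * ennreal (indicator {0..span_Z x} z / span_Z x) \<partial>M)
        = (\<integral>\<^sup>+x. ennreal (indicator (B \<inter> {0..}) z * (indicator {z..} (span_Z x) * indicator {..s} (z * ratio_SZ x) / span_Z x)) \<partial>M)"
      by (intro nn_integral_cong) (auto simp: ennreal_mult[symmetric] split: split_indicator)
    also have "\<dots> = ennreal (indicator (B \<inter> {0..}) z * Z_density_le M z s)"
      unfolding Z_density_le_def
      by (subst nn_integral_eq_integral[OF integrable_mult_right[OF integrable_Z_density_le]])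
         (simp_all add: less_imp_le del: times_divide_eq_right)
    finally show "(\<integral>\<^sup>+x. ennreal (indicator B z * indicator {..s} (z * ratio_SZ x)) * ennreal (indicator {0..span_Z x} z / span_Z x) \<partial>M)
        = ennreal (indicator (B \<inter> {0..}) z * Z_density_le M z s)" .
  qed
  finally show ?thesis .
qed

theorem cond_cdf_version_cond_cdf: "cond_cdf_version (exterior_law \<Otimes>\<^sub>M M) (cond_cdf M)"
proof -
  interpret E: prob_space exterior_law
    by (rule prob_space_exterior_law)
  interpret P: pair_prob_space exterior_law M ..
  let ?\<mu> = "exterior_law \<Otimes>\<^sub>M M"
  let ?F = "vimage_algebra (space ?\<mu>) Z_stat borel"
  have sets_\<mu> [measurable_cong]: "sets ?\<mu> = sets (borel \<Otimes>\<^sub>M borel)"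
    by (intro sets_pair_measure_cong) auto
  have Zm [measurable]: "Z_stat \<in> borel_measurable ?\<mu>" by measurable
  have Sm [measurable]: "S_stat \<in> borel_measurable ?\<mu>" by measurable
  have "subalgebra ?\<mu> ?F"
    unfolding subalgebra_def using measurable_sets[OF Zm] by (auto simp: sets_vimage_algebra2)
  then interpret F: finite_measure_subalgebra ?\<mu> ?F
    by unfold_locales
  have "AE p in ?\<mu>. cond_cdf M (Z_stat p) s = real_cond_exp ?\<mu> ?F (indicator {p. S_stat p \<le> s}) p" for s
  proof -
    let ?I = "indicator {p. S_stat p \<le> s} :: _ \<Rightarrow> real"
    have I [measurable]: "?I \<in> borel_measurable ?\<mu>"
      by measurable
    have int_I: "integrable ?\<mu> ?I" and int_G: "integrable ?\<mu> (\<lambda>p. cond_cdf M (Z_stat p) s)"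
      using cond_cdf_nonneg cond_cdf_le_1 by (auto intro!: P.P.integrable_const_bound[of _ 1])
    have "AE p in ?\<mu>. real_cond_exp ?\<mu> ?F ?I p = cond_cdf M (Z_stat p) s"
    proof (rule F.real_cond_exp_charact[OF _ int_I int_G])
      show "(\<lambda>p. cond_cdf M (Z_stat p) s) \<in> borel_measurable ?F"
        by (rule measurable_compose[OF measurable_vimage_algebra1]) auto
      fix A assume "A \<in> sets ?F"
      then obtain B where B [measurable]: "B \<in> sets borel" and A: "A = Z_stat -` B \<inter> space ?\<mu>"
        by (auto simp: sets_vimage_algebra2)
      have "(\<integral>p\<in>A. ?I p \<partial>?\<mu>) = enn2real (\<integral>\<^sup>+p. ennreal (indicator B (Z_stat p) * ?I p) \<partial>?\<mu>)"
        unfolding set_lebesgue_integral_def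
        by (subst integral_eq_nn_integral)
           (auto simp: A indicator_def intro!: arg_cong[where f = enn2real] nn_integral_cong)
      also have "\<dots> = enn2real (\<integral>\<^sup>+p. ennreal (indicator B (Z_stat p) * cond_cdf M (Z_stat p) s) \<partial>?\<mu>)"
        by (subst nn_integral_indicator_Z_times)
           (simp_all add: nn_integral_indicator_Z_S cond_cdf_nonneg cond_cdf_times_Z_density mult.assoc)
      also have "\<dots> = (\<integral>p\<in>A. cond_cdf M (Z_stat p) s \<partial>?\<mu>)"
        unfolding set_lebesgue_integral_def
        by (subst integral_eq_nn_integral)
           (auto simp: A indicator_def cond_cdf_nonneg intro!: arg_cong[where f = enn2real] nn_integral_cong)
      finally show "(\<integral>p\<in>A. ?I p \<partial>?\<mu>) = (\<integral>p\<in>A. cond_cdf M (Z_stat p) s \<partial>?\<mu>)" .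
    qed
    then show ?thesis by auto
  qed
  then show ?thesis
    using cond_cdf_mono cond_cdf_right_continuous cond_cdf_nonneg cond_cdf_at_1
    by (auto simp: cond_cdf_version_def intro!: measurable_restrict_space1 monoI mono_onI dest: monoD)
qed

end

section \<open>Reduction to a function of one variable\<close>

text \<open>
  The increasing function \<open>ratio_SZ\<close> has the inverse \<open>level\<close> (lemma \<open>ratio_SZ_le_iff\<close>). Hence \<open>profile \<nu> u\<close>
  collects the weight of the interior times with \<open>S / Z \<le> u\<close>, without any constraint on \<open>Z\<close>.
\<close>

definition level :: "real \<Rightarrow> real" where
  "level u = (ln (1 + 2 * u) - ln (1 - u)) / 4"

definition profile :: "real measure \<Rightarrow> real \<Rightarrow> real" where
  "profile \<nu> u = (\<integral>x. indicator {..level u} x / span_Z x \<partial>\<nu>)"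

lemma ratio_SZ_le_iff:
  assumes "0 \<le> u" "u < 1"
  shows "ratio_SZ x \<le> u \<longleftrightarrow> x \<le> level u"
proof -
  let ?y = "exp (- 4 * x)"
  have "ratio_SZ x \<le> u \<longleftrightarrow> 1 - u \<le> ?y * (1 + 2 * u)"
    using span_Z_pos(1)[of x] by (simp add: ratio_SZ_def divide_le_eq) (auto simp: span_Z_def algebra_simps)
  also have "\<dots> \<longleftrightarrow> ln (1 - u) \<le> ln (?y * (1 + 2 * u))"
    using assms by (intro ln_le_cancel_iff[symmetric]) auto
  also have "\<dots> \<longleftrightarrow> x \<le> level u"
    using assms by (simp add: ln_mult level_def) linarith
  finally show ?thesis .
qed

lemma span_Z_level:
  assumes "0 \<le> u" "u < 1"
  shows "span_Z (level u) = 3 / (1 + 2 * u)"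
proof -
  have "- 4 * level u = ln (1 - u) - ln (1 + 2 * u)"
    by (simp add: level_def)
  then have "exp (- 4 * level u) = (1 - u) / (1 + 2 * u)"
    using assms by (simp only: exp_diff) simp
  then show ?thesis
    using assms by (simp add: span_Z_def field_simps)
qed

lemma DERIV_level:
  assumes "0 \<le> u" "u < 1"
  shows "(level has_real_derivative 3 / (4 * (1 + 2 * u) * (1 - u))) (at u)"
proof -
  have "(level has_real_derivative (2 / (1 + 2 * u) + 1 / (1 - u)) / 4) (at u)"
    unfolding level_def using assms by (auto intro!: derivative_eq_intros)
  moreover have "(2 / (1 + 2 * u) + 1 / (1 - u)) / 4 = 3 / (4 * (1 + 2 * u) * (1 - u))"
    using assms by (simp add: divide_simps)
  ultimately show ?thesis by simp
qed

lemma level_0 [simp]: "level 0 = 0"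
  by (simp add: level_def)

lemma level_pos: "0 < u \<Longrightarrow> u < 1 \<Longrightarrow> 0 < level u"
  by (simp add: level_def)

lemma tendsto_level_0: "(level \<longlongrightarrow> 0) (at_right 0)"
  unfolding level_def by real_asymp

lemma span_Z_antimono: "x \<le> y \<Longrightarrow> span_Z y \<le> span_Z x"
  by (simp add: span_Z_def)

text \<open>
  A small value of \<open>S / Z\<close> means a small interior time, hence a value of \<open>span_Z\<close> close to its maximum 3 on
  nonnegative times. The bound \<open>z + 2 s \<le> 3\<close> is the exact condition for \<open>z \<le> span_Z (level (s / z))\<close>.
\<close>

lemma le_span_Z_if_ratio_SZ_le:
  assumes "0 < z" "0 \<le> s" "s < z" "z + 2 * s \<le> 3" "x \<le> level (s / z)"
  shows "z \<le> span_Z x"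
proof -
  have "z * (z + 2 * s) \<le> z * 3"
    using assms by (intro mult_left_mono) auto
  then have "z \<le> 3 / (1 + 2 * (s / z))"
    using assms by (simp add: field_simps)
  also have "\<dots> = span_Z (level (s / z))"
    using assms by (intro span_Z_level[symmetric]) auto
  also have "\<dots> \<le> span_Z x"
    using assms by (intro span_Z_antimono)
  finally show ?thesis .
qed

context real_distribution
begin

lemma Z_density_le_eq_profile:
  assumes "0 < z" "0 \<le> s" "s < z" "z + 2 * s \<le> 3"
  shows "Z_density_le M z s = profile M (s / z)"
  unfolding Z_density_le_def profile_def
proof (intro Bochner_Integration.integral_cong refl)
  fix x
  have "z * ratio_SZ x \<le> s \<longleftrightarrow> x \<le> level (s / z)"
    using assms ratio_SZ_le_iff[of "s / z" x] by (simp add: field_simps)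
  then show "indicator {z..} (span_Z x) * indicator {..s} (z * ratio_SZ x) / span_Z x
      = indicator {..level (s / z)} x / span_Z x"
    using le_span_Z_if_ratio_SZ_le[OF assms, of x] by (auto split: split_indicator)
qed

lemma Z_density_antimono: "z \<le> z' \<Longrightarrow> Z_density M z' \<le> Z_density M z"
  unfolding Z_density_def
  by (intro integral_mono integrable_Z_density) (auto simp: divide_right_mono less_imp_le split: split_indicator)

text \<open>
  Small interior times have positive probability, and for them \<open>span_Z\<close> exceeds any given \<open>z < 3\<close>.
\<close>

lemma Z_density_pos:
  assumes pos: "\<And>a. 0 < a \<Longrightarrow> 0 < prob {0..a}" and "z < 3"
  shows "0 < Z_density M z"
proof (rule ccontr)
  assume "\<not> 0 < Z_density M z"
  then have "Z_density M z = 0"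
    using Z_density_nonneg[of z] by simp
  then have *: "AE x in M. indicator {z..} (span_Z x) / span_Z x = (0 :: real)"
    unfolding Z_density_def
    by (subst (asm) integral_nonneg_eq_0_iff_AE[OF integrable_Z_density]) (auto simp: less_imp_le)
  have "(span_Z \<longlongrightarrow> 3) (at_right 0)"
    unfolding span_Z_def by real_asymp
  then have "eventually (\<lambda>a. z < span_Z a) (at_right 0)"
    using \<open>z < 3\<close> by (rule order_tendstoD)
  then obtain d where "0 < d" and d: "\<And>a. 0 < a \<Longrightarrow> a < d \<Longrightarrow> z < span_Z a"
    unfolding eventually_at_right_field by auto
  define a where "a = d / 2"
  have a: "0 < a" "z < span_Z a"
    using d[of a] \<open>0 < d\<close> by (auto simp: a_def)
  have "AE x in M. x \<notin> {0..a}"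
    using * by eventually_elim (use a span_Z_antimono in \<open>force split: split_indicator_asm\<close>)
  then have "prob {0..a} = 0"
    by (subst prob_eq_0) auto
  with pos[OF a(1)] show False by simp
qed

lemma cond_cdf_eq_profile:
  assumes "0 < z" "0 \<le> s" "s < z" "z + 2 * s \<le> 3" "0 < Z_density M z"
  shows "cond_cdf M z s = profile M (s / z) / Z_density M z"
  using assms by (simp add: cond_cdf_def Z_density_le_eq_profile)

text \<open>
  Three terms with exponents \<open>\<alpha>, \<alpha> + 1, \<alpha> + 2\<close> reach exactly the order that an expansion of a tempered law
  must have. The interval of the \<open>z\<close> is chosen with a positive distance from 0 and 3, so that the powers
  of \<open>1 / z\<close> and the factor \<open>1 / Z_density \<nu> z\<close>, which come from \<open>u = s / z\<close> and from the
  normalization, stay bounded on it.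
\<close>

lemma small_s_expansion_cond_cdf:
  assumes pos: "\<And>a. 0 < a \<Longrightarrow> 0 < prob {0..a}"
    and "0 < u0" "u0 < 1" "0 < \<alpha>"
    and expansion: "\<And>u. u \<in> {0..u0} \<Longrightarrow>
      \<bar>profile M u - (\<Sum>i<3. d i * u powr (\<alpha> + real i))\<bar> \<le> K * u powr (\<alpha> + 3)"
    and "0 < t"
  shows "small_s_expansion (cond_cdf M) t"
proof -
  \<comment> \<open>The point \<open>4 * q0 t - 1\<close>, and the end points of an interval around it inside \<open>(0, 3)\<close>.\<close>
  define zt where "zt = 3 * exp (- 4 * t)"
  have zt: "0 < zt" "zt < 3" "4 * q0 t - 1 = zt"
    using \<open>0 < t\<close> by (auto simp: zt_def q0_def add_divide_distrib)
  define z0 z1 where "z0 = zt / 2" and "z1 = (zt + 3) / 2"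
  have z01: "0 < z0" "z0 < zt" "zt < z1" "z1 < 3"
    using zt by (auto simp: z0_def z1_def)
  \<comment> \<open>For \<open>s \<le> s0\<close> and \<open>z\<close> in the interval, \<open>z + 2 * s \<le> 3\<close> and \<open>s / z \<le> u0\<close>.\<close>
  define s0 where "s0 = min ((3 - z1) / 2) (min 1 (z0 * u0))"
  define I where "I = {z0<..<z1}"
  define F where "F = (\<lambda>i z. d i * z powr (- (\<alpha> + real i)) / Z_density M z)"
  define \<kappa> where "\<kappa> = (\<bar>K\<bar> + 1) * z0 powr (- (\<alpha> + 3)) / Z_density M z1"
  have Z_density_z1: "0 < Z_density M z1"
    by (rule Z_density_pos) (use pos z01 in auto)
  have Z_density_I: "Z_density M z1 \<le> Z_density M z" if "z \<in> I" for z
    using that by (intro Z_density_antimono) (auto simp: I_def)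
  have \<kappa>: "0 < \<kappa>"
    using Z_density_z1 z01 by (auto simp: \<kappa>_def)
  have bdd: "bounded (F i ` I)" for i
  proof -
    have "\<bar>F i z\<bar> \<le> \<bar>d i\<bar> * z0 powr (- (\<alpha> + real i)) / Z_density M z1" if "z \<in> I" for z
    proof -
      have "z powr (- (\<alpha> + real i)) \<le> z0 powr (- (\<alpha> + real i))"
        using that z01 \<open>0 < \<alpha>\<close> by (intro powr_mono2') (auto simp: I_def)
      then show ?thesis
        using Z_density_I[OF that] Z_density_z1
        by (auto simp: F_def abs_mult intro!: frac_le mult_left_mono)
    qed
    then show ?thesis
      unfolding bounded_iff by (intro exI[of _ "\<bar>d i\<bar> * z0 powr (- (\<alpha> + real i)) / Z_density M z1"]) auto
  qed
  have err: "\<bar>cond_cdf M z s - (\<Sum>i<3. F i z * s powr (\<alpha> + real i))\<bar> \<le> \<kappa> * s powr (\<alpha> + 3)"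
    if s: "s \<in> {0..s0}" and z: "z \<in> I" for s z
  proof -
    have z': "z0 < z" "z < z1" "0 < z" "0 < Z_density M z"
      using z z01 Z_density_I[OF z] Z_density_z1 by (auto simp: I_def)
    have "s \<le> z0 * u0" "0 \<le> s" "s \<le> (3 - z1) / 2"
      using s by (auto simp: s0_def)
    moreover have "z0 * u0 < z0 * 1" "z0 * u0 \<le> z * u0"
      using z01 \<open>0 < u0\<close> \<open>u0 < 1\<close> z' by (auto intro: mult_strict_left_mono mult_right_mono)
    ultimately have s': "0 \<le> s" "s < z" "z + 2 * s \<le> 3" "s / z \<le> u0"
      using z' by (auto simp: field_simps)
    have powr: "(s / z) powr e = s powr e * z powr (- e)" for e
      using s'(1) z' by (simp add: powr_divide powr_minus field_simps)
    have "\<bar>profile M (s / z) - (\<Sum>i<3. d i * (s / z) powr (\<alpha> + real i))\<bar> \<le> K * (s / z) powr (\<alpha> + 3)"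
      using s' z' by (intro expansion) auto
    then have "\<bar>profile M (s / z) - (\<Sum>i<3. d i * (s / z) powr (\<alpha> + real i))\<bar> / Z_density M z
        \<le> K * (s / z) powr (\<alpha> + 3) / Z_density M z"
      using z' by (intro divide_right_mono) auto
    also have "\<bar>profile M (s / z) - (\<Sum>i<3. d i * (s / z) powr (\<alpha> + real i))\<bar> / Z_density M z
        = \<bar>cond_cdf M z s - (\<Sum>i<3. F i z * s powr (\<alpha> + real i))\<bar>"
    proof -
      have "(\<Sum>i<3. F i z * s powr (\<alpha> + real i)) = (\<Sum>i<3. d i * (s / z) powr (\<alpha> + real i)) / Z_density M z"
        unfolding sum_divide_distrib by (intro sum.cong) (auto simp: F_def powr)
      then show ?thesis
        using z' s' by (simp add: cond_cdf_eq_profile diff_divide_distrib[symmetric] abs_divide)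
    qed
    also have "K * (s / z) powr (\<alpha> + 3) / Z_density M z = (K * z powr (- (\<alpha> + 3)) / Z_density M z) * s powr (\<alpha> + 3)"
      unfolding powr by simp
    also have "\<dots> \<le> \<kappa> * s powr (\<alpha> + 3)"
    proof (rule mult_right_mono)
      have "z powr (- (\<alpha> + 3)) \<le> z0 powr (- (\<alpha> + 3))"
        using z' z01 \<open>0 < \<alpha>\<close> by (intro powr_mono2') auto
      then have "K * z powr (- (\<alpha> + 3)) \<le> (\<bar>K\<bar> + 1) * z0 powr (- (\<alpha> + 3))"
        by (intro mult_mono) auto
      then show "K * z powr (- (\<alpha> + 3)) / Z_density M z \<le> \<kappa>"
        unfolding \<kappa>_def using Z_density_I[OF z] Z_density_z1 by (intro frac_le) auto
    qed simp
    finally show ?thesis .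
  qed
  show ?thesis
    unfolding small_s_expansion_def
  proof (intro exI conjI)
    show "0 < s0" "s0 \<le> 1" "is_interval I" "I \<subseteq> {0<..<3}" "4 * q0 t - 1 \<in> interior I"
      using z01 zt \<open>0 < u0\<close> by (auto simp: s0_def I_def is_interval_oo)
    show "\<forall>s\<in>{0..s0}. \<forall>z\<in>I. \<bar>cond_cdf M z s - (\<Sum>i<3. F i z * s powr (\<alpha> + real i))\<bar> \<le> \<kappa> * s powr (\<alpha> + real 3)"
      using err by simp
  qed (use \<kappa> bdd \<open>0 < \<alpha>\<close> in auto)
qed

end

section \<open>Interior times with a density\<close>

locale interior_density =
  fixes h :: "real \<Rightarrow> real" and b :: real
  assumes measurable_h [measurable]: "h \<in> borel_measurable borel"
    and h_nonneg: "\<And>x. 0 \<le> h x"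
    and h_neg: "\<And>x. x < 0 \<Longrightarrow> h x = 0"
    and h_large: "\<And>x. b < x \<Longrightarrow> h x = 0"
    and b_pos: "0 < b"
    and h_cont: "\<And>x. 0 < x \<Longrightarrow> x < b \<Longrightarrow> isCont h x"
    and h_prob: "prob_space (density lborel (\<lambda>x. ennreal (h x)))"
begin

abbreviation \<nu> where "\<nu> \<equiv> density lborel (\<lambda>x. ennreal (h x))"

sublocale real_distribution \<nu>
  using h_prob by (auto simp: real_distribution_def real_distribution_axioms_def)

lemma integrable_h: "integrable lborel h"
proof -
  have "(\<integral>\<^sup>+x. ennreal (h x) \<partial>lborel) = 1"
    using emeasure_space_1 by (simp add: emeasure_density)
  then show ?thesis
    by (intro integrableI_nonneg) (auto simp: h_nonneg)
qed

lemma integrable_h_span: "(\<lambda>x. h x / span_Z x) integrable_on {0..a}"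
  "set_integrable lborel {0..a} (\<lambda>x. h x / span_Z x)"
proof -
  have bound: "norm (h x / span_Z x) \<le> norm (h x)" for x
  proof -
    have "h x / span_Z x \<le> h x / 1"
      by (rule divide_left_mono[OF abs_span_Z_ge_1(2) h_nonneg]) simp
    then show ?thesis
      by (simp add: abs_divide h_nonneg abs_of_pos)
  qed
  have "integrable lborel (\<lambda>x. h x / span_Z x)"
    by (rule Bochner_Integration.integrable_bound[OF integrable_h _ AE_I2[OF bound]]) measurable
  then show *: "set_integrable lborel {0..a} (\<lambda>x. h x / span_Z x)"
    unfolding set_integrable_def by (rule integrable_mult_indicator[rotated]) auto
  show "(\<lambda>x. h x / span_Z x) integrable_on {0..a}"
    using set_borel_integral_eq_integral(1)[OF *] .
qed

lemma profile_eq_integral: "profile \<nu> u = integral {0..level u} (\<lambda>x. h x / span_Z x)"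
proof -
  have "profile \<nu> u = (\<integral>x. h x * (indicator {..level u} x / span_Z x) \<partial>lborel)"
    unfolding profile_def by (subst integral_density) (auto simp: h_nonneg)
  also have "\<dots> = (LINT x:{0..level u}|lborel. h x / span_Z x)"
    unfolding set_lebesgue_integral_def
    by (intro Bochner_Integration.integral_cong) (auto simp: h_neg split: split_indicator)
  also have "\<dots> = integral {0..level u} (\<lambda>x. h x / span_Z x)"
    by (rule set_borel_integral_eq_integral(2)[OF integrable_h_span(2)])
  finally show ?thesis .
qed

lemma profile_0: "profile \<nu> 0 = 0"
  by (simp add: profile_eq_integral)

lemma tendsto_profile_0: "(profile \<nu> \<longlongrightarrow> 0) (at_right 0)"
proof -
  have "continuous_on {0..1} (\<lambda>a. integral {0..a} (\<lambda>x. h x / span_Z x))"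
    by (rule indefinite_integral_continuous_1) (rule integrable_h_span)
  then have "((\<lambda>a. integral {0..a} (\<lambda>x. h x / span_Z x)) \<longlongrightarrow> 0) (at 0 within {0..1})"
    by (force simp: continuous_on)
  moreover have "filterlim level (at 0 within {0..1}) (at_right 0)"
    unfolding filterlim_at
  proof
    have "eventually (\<lambda>u. level u < 1) (at_right 0)"
      by (rule order_tendstoD[OF tendsto_level_0]) simp
    moreover have "eventually (\<lambda>u::real. 0 < u \<and> u < 1) (at_right 0)"
      by (auto simp: eventually_at_right_field intro!: exI[of _ 1])
    ultimately show "eventually (\<lambda>u. level u \<in> {0..1} \<and> level u \<noteq> 0) (at_right 0)"
      by eventually_elim (use level_pos in force)
  qed (rule tendsto_level_0)
  ultimately show ?thesis
    unfolding profile_eq_integral[abs_def] by (rule filterlim_compose)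
qed

text \<open>
  In the chain rule, \<open>1 / span_Z (level u) = (1 + 2 u) / 3\<close> cancels against the derivative
  \<open>3 / (4 (1 + 2 u) (1 - u))\<close> of \<open>level\<close>, up to the factor \<open>1 / (4 (1 - u))\<close>.
\<close>

lemma DERIV_profile:
  assumes "0 < u" "u < 1" "level u < b"
  shows "(profile \<nu> has_real_derivative h (level u) / (4 * (1 - u))) (at u)"
proof -
  let ?g = "\<lambda>x. h x / span_Z x" and ?a = "level u"
  have a: "0 < ?a"
    using assms by (simp add: level_pos)
  have "continuous (at ?a within {0..b} - {}) ?g"
  proof (rule continuous_at_imp_continuous_within)
    have "isCont span_Z ?a"
      unfolding span_Z_def by (intro continuous_intros)
    then show "isCont ?g ?a"
      by (rule isCont_divide[OF h_cont[OF a assms(3)]]) simp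
  qed
  then have "((\<lambda>y. integral {0..y} ?g) has_vector_derivative ?g ?a) (at ?a within ({0..b} - {}))"
    using a assms by (intro integral_has_vector_derivative_continuous_at integrable_h_span) auto
  moreover have "at ?a within {0..b} = at ?a"
    using a assms by (intro at_within_interior) auto
  ultimately have "((\<lambda>y. integral {0..y} ?g) has_real_derivative ?g ?a) (at ?a)"
    by (simp add: has_real_derivative_iff_has_vector_derivative)
  from DERIV_chain2[OF this DERIV_level] assms
  have "(profile \<nu> has_real_derivative ?g ?a * (3 / (4 * (1 + 2 * u) * (1 - u)))) (at u)"
    unfolding profile_eq_integral[abs_def] by auto
  also have "?g ?a * (3 / (4 * (1 + 2 * u) * (1 - u))) = h ?a / (4 * (1 - u))"
    using assms by (simp add: span_Z_level divide_simps) (simp add: algebra_simps)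
  finally show ?thesis .
qed

lemma eventually_DERIV_profile:
  "eventually (\<lambda>u. 0 < u \<and> u < 1 \<and> 0 < level u \<and> level u < b \<and>
     (profile \<nu> has_real_derivative h (level u) / (4 * (1 - u))) (at u)) (at_right 0)"
proof -
  have "eventually (\<lambda>u. level u < b) (at_right 0)"
    by (rule order_tendstoD[OF tendsto_level_0]) (rule b_pos)
  moreover have "eventually (\<lambda>u::real. 0 < u \<and> u < 1) (at_right 0)"
    by (auto simp: eventually_at_right_field intro!: exI[of _ 1])
  ultimately show ?thesis
    by eventually_elim (use DERIV_profile level_pos in auto)
qed

end

section \<open>Power densities: an expansion in powers\<close>

lemma nonneg_of_deriv_nonneg_at_right_0:
  fixes f :: "real \<Rightarrow> real"
  assumes lim: "(f \<longlongrightarrow> 0) (at_right 0)"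
    and deriv: "\<And>x. 0 < x \<Longrightarrow> x \<le> u \<Longrightarrow> \<exists>y. (f has_real_derivative y) (at x) \<and> 0 \<le> y"
    and "0 < u"
  shows "0 \<le> f u"
proof (rule tendsto_upperbound[OF lim])
  have "f x \<le> f u" if "0 < x" "x < u" for x
  proof (rule DERIV_nonneg_imp_nondecreasing[of x u f])
    show "\<exists>y. (f has_real_derivative y) (at v) \<and> 0 \<le> y" if "x \<le> v" "v \<le> u" for v
      by (rule deriv) (use that \<open>0 < x\<close> in linarith)+
  qed (use that in simp)
  then show "eventually (\<lambda>x. f x \<le> f u) (at_right 0)"
    using \<open>0 < u\<close> by (auto simp: eventually_at_right_field)
qed simp

text \<open>
  The second order Taylor expansion at 0 of the analytic factor of the derivative of the profile. It is
  obtained from \<open>level v = (3/4) v (1 - v/2 + v\<^sup>2 + ...)\<close>, the binomial series and the geometric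
  series. After division by \<open>(3/4) v\<close> the leading coefficient is 1.
\<close>

lemma powr_density_Taylor:
  fixes a :: real
  shows "(\<lambda>v. (level v / (3/4 * v)) powr a / (1 - v)
    - (1 + (1 - a/2) * v + (1 + a/2 + a * (a - 1) / 8) * v\<^sup>2)) \<in> O[at_right 0](\<lambda>v. v ^ 3)"
  unfolding level_def by real_asymp

context interior_density
begin

text \<open>
  Integrate the expansion of the derivative term by term. The estimate of the error is transferred from the
  derivative to the function by monotonicity: error bound minus or plus the difference has a nonnegative
  derivative and tends to 0 at 0.
\<close>

lemma profile_expansion:
  assumes h: "\<And>x. 0 < x \<Longrightarrow> x < b \<Longrightarrow> h x = c * x powr (\<theta> - 1)" and "0 < \<theta>"
  shows "\<exists>u0 d K. 0 < u0 \<and> u0 < 1 \<and>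
    (\<forall>u\<in>{0..u0}. \<bar>profile \<nu> u - (\<Sum>i<3. d i * u powr (\<theta> + real i))\<bar> \<le> K * u powr (\<theta> + 3))"
proof -
  \<comment> \<open>The derivative of the profile is approximately \<open>C * u powr a * (r 0 + r 1 * u + r 2 * u\<^sup>2)\<close>; the
    numbers \<open>d i\<close> and \<open>K\<close> arise by integrating this and the error term \<open>\<bar>C\<bar> * K1 * u powr (\<theta> + 2)\<close>.\<close>
  define a where "a = \<theta> - 1"
  define r where "r = (\<lambda>i::nat. if i = 0 then 1 else if i = 1 then 1 - a/2 else 1 + a/2 + a * (a - 1) / 8)"
  define C where "C = c * (3/4) powr a / 4"
  define d where "d = (\<lambda>i. C * r i / (\<theta> + real i))"
  obtain K1 where K1: "eventually (\<lambda>v. norm ((level v / (3/4 * v)) powr a / (1 - v)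
      - (1 + (1 - a/2) * v + (1 + a/2 + a * (a - 1) / 8) * v\<^sup>2)) \<le> K1 * norm (v ^ 3)) (at_right 0)"
    by (rule landau_o.bigE[OF powr_density_Taylor[of a]])
  define K where "K = \<bar>C\<bar> * K1 / (\<theta> + 3)"
  define P where "P = (\<lambda>u. \<Sum>i<3. d i * u powr (\<theta> + real i))"
  define E where "E = (\<lambda>u. K * u powr (\<theta> + 3))"
  have "eventually (\<lambda>u. u < 1 \<and> (profile \<nu> has_real_derivative h (level u) / (4 * (1 - u))) (at u) \<and>
      \<bar>h (level u) / (4 * (1 - u)) - C * u powr a * (\<Sum>i<3. r i * u ^ i)\<bar> \<le> \<bar>C\<bar> * K1 * u powr (\<theta> + 2)) (at_right 0)"
    using K1 eventually_DERIV_profile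
  proof eventually_elim
    case (elim u)
    define m where "m = level u / (3/4 * u)"
    have m: "0 < m" "level u = 3/4 * u * m"
      using elim by (auto simp: m_def)
    have "h (level u) = c * level u powr a"
      using elim h[of "level u"] by (simp add: a_def)
    also have "level u powr a = (3/4) powr a * u powr a * m powr a"
      unfolding m(2) using elim m(1)
      by (simp add: powr_mult del: times_divide_eq_left times_divide_eq_right)
    finally have "h (level u) / (4 * (1 - u)) = C * u powr a * (m powr a / (1 - u))"
      by (simp add: C_def)
    moreover have "(\<Sum>i<3. r i * u ^ i) = 1 + (1 - a/2) * u + (1 + a/2 + a * (a - 1) / 8) * u\<^sup>2"
      by (simp add: r_def eval_nat_numeral)
    ultimately have "h (level u) / (4 * (1 - u)) - C * u powr a * (\<Sum>i<3. r i * u ^ i)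
        = C * u powr a * (m powr a / (1 - u) - (1 + (1 - a/2) * u + (1 + a/2 + a * (a - 1) / 8) * u\<^sup>2))"
      by (simp only: right_diff_distrib)
    then have "\<bar>h (level u) / (4 * (1 - u)) - C * u powr a * (\<Sum>i<3. r i * u ^ i)\<bar>
        = \<bar>C\<bar> * u powr a * \<bar>m powr a / (1 - u) - (1 + (1 - a/2) * u + (1 + a/2 + a * (a - 1) / 8) * u\<^sup>2)\<bar>"
      by (simp only: abs_mult abs_of_nonneg[OF powr_ge_zero])
    also have "\<dots> \<le> \<bar>C\<bar> * u powr a * (K1 * u ^ 3)"
      using elim(1,2) by (intro mult_left_mono) (simp_all add: m_def)
    also have "u ^ 3 = u powr 3"
      using elim by (simp add: powr_numeral)
    also have "\<bar>C\<bar> * u powr a * (K1 * u powr 3) = \<bar>C\<bar> * K1 * (u powr a * u powr 3)"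
      by simp
    also have "u powr a * u powr 3 = u powr (\<theta> + 2)"
      by (simp add: powr_add[symmetric] a_def add.commute)
    finally show ?case
      using elim by blast
  qed
  then obtain u1 where "0 < u1" and u1: "\<And>u. 0 < u \<Longrightarrow> u < u1 \<Longrightarrow> u < 1 \<and>
      (profile \<nu> has_real_derivative h (level u) / (4 * (1 - u))) (at u) \<and>
      \<bar>h (level u) / (4 * (1 - u)) - C * u powr a * (\<Sum>i<3. r i * u ^ i)\<bar> \<le> \<bar>C\<bar> * K1 * u powr (\<theta> + 2)"
    by (auto simp: eventually_at_right_field)
  define u0 where "u0 = min (1/2) (u1 / 2)"
  have u0: "0 < u0" "u0 < 1" "u0 < u1"
    using \<open>0 < u1\<close> by (auto simp: u0_def)
  have DP: "(P has_real_derivative C * u powr a * (\<Sum>i<3. r i * u ^ i)) (at u)" if "0 < u" for u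
  proof -
    have "((\<lambda>u. d i * u powr (\<theta> + real i)) has_real_derivative C * u powr a * (r i * u ^ i)) (at u)" for i
    proof -
      have "((\<lambda>u. d i * u powr (\<theta> + real i)) has_real_derivative
          d i * ((\<theta> + real i) * u powr (\<theta> + real i - 1))) (at u)"
        using that by (auto intro!: derivative_eq_intros has_real_derivative_powr)
      moreover have "d i * (\<theta> + real i) = C * r i"
        using \<open>0 < \<theta>\<close> by (simp add: d_def)
      then have "d i * ((\<theta> + real i) * u powr (\<theta> + real i - 1)) = C * r i * u powr (a + real i)"
        by (simp only: mult.assoc[symmetric] a_def) (simp add: algebra_simps)
      moreover have "u powr (a + real i) = u powr a * u ^ i"
        using that by (simp add: powr_add powr_realpow)
      ultimately show ?thesis by (simp add: mult_ac)
    qed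
    then show ?thesis
      unfolding P_def sum_distrib_left by (intro DERIV_sum) 
  qed
  have DE: "(E has_real_derivative \<bar>C\<bar> * K1 * u powr (\<theta> + 2)) (at u)" if "0 < u" for u
  proof -
    have "(E has_real_derivative K * ((\<theta> + 3) * u powr (\<theta> + 3 - 1))) (at u)"
      unfolding E_def using that by (auto intro!: derivative_eq_intros has_real_derivative_powr)
    moreover have "K * ((\<theta> + 3) * u powr (\<theta> + 3 - 1)) = \<bar>C\<bar> * K1 * u powr (\<theta> + 2)"
      using \<open>0 < \<theta>\<close> by (simp add: K_def add.commute)
    ultimately show ?thesis by simp
  qed
  have lim_powr: "((\<lambda>u::real. u powr e) \<longlongrightarrow> 0) (at_right 0)" if "0 < e" for e
    using that by real_asymp
  have lim_P: "(P \<longlongrightarrow> 0) (at_right 0)"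
    unfolding P_def using \<open>0 < \<theta>\<close> by (intro tendsto_null_sum tendsto_mult_right_zero lim_powr) auto
  have lim_E: "(E \<longlongrightarrow> 0) (at_right 0)"
    unfolding E_def using \<open>0 < \<theta>\<close> by (intro tendsto_mult_right_zero lim_powr) auto
  \<comment> \<open>This bound is the derivative of \<open>E\<close>, so that \<open>E\<close> dominates \<open>profile \<nu> - P\<close>.\<close>
  have deriv: "(profile \<nu> has_real_derivative h (level x) / (4 * (1 - x))) (at x)"
    and bound: "\<bar>h (level x) / (4 * (1 - x)) - C * x powr a * (\<Sum>i<3. r i * x ^ i)\<bar> \<le> \<bar>C\<bar> * K1 * x powr (\<theta> + 2)"
    if "0 < x" "x \<le> u0" for x
    using u1[of x] that u0 by auto
  have main: "\<bar>profile \<nu> u - P u\<bar> \<le> E u" if u: "0 < u" "u \<le> u0" for u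
  proof -
    have "0 \<le> E u - (profile \<nu> u - P u)"
    proof (rule nonneg_of_deriv_nonneg_at_right_0[of "\<lambda>u. E u - (profile \<nu> u - P u)"])
      show "((\<lambda>u. E u - (profile \<nu> u - P u)) \<longlongrightarrow> 0) (at_right 0)"
        using tendsto_diff[OF lim_E tendsto_diff[OF tendsto_profile_0 lim_P]] by simp
      fix x assume x: "0 < x" "x \<le> u"
      then have x': "0 < x" "x \<le> u0"
        using u by auto
      show "\<exists>y. ((\<lambda>u. E u - (profile \<nu> u - P u)) has_real_derivative y) (at x) \<and> 0 \<le> y"
        using DERIV_diff[OF DE[OF x(1)] DERIV_diff[OF deriv[OF x'] DP[OF x(1)]]] bound[OF x']
        by - (intro exI conjI, assumption, linarith)
    qed (use u in auto)
    moreover have "0 \<le> E u + (profile \<nu> u - P u)"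
    proof (rule nonneg_of_deriv_nonneg_at_right_0[of "\<lambda>u. E u + (profile \<nu> u - P u)"])
      show "((\<lambda>u. E u + (profile \<nu> u - P u)) \<longlongrightarrow> 0) (at_right 0)"
        using tendsto_add[OF lim_E tendsto_diff[OF tendsto_profile_0 lim_P]] by simp
      fix x assume x: "0 < x" "x \<le> u"
      then have x': "0 < x" "x \<le> u0"
        using u by auto
      show "\<exists>y. ((\<lambda>u. E u + (profile \<nu> u - P u)) has_real_derivative y) (at x) \<and> 0 \<le> y"
        using DERIV_add[OF DE[OF x(1)] DERIV_diff[OF deriv[OF x'] DP[OF x(1)]]] bound[OF x']
        by - (intro exI conjI, assumption, linarith)
    qed (use u in auto)
    ultimately show ?thesis by (simp add: abs_le_iff)
  qed
  have "\<forall>u\<in>{0..u0}. \<bar>profile \<nu> u - P u\<bar> \<le> E u"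
  proof
    fix u assume "u \<in> {0..u0}"
    then show "\<bar>profile \<nu> u - P u\<bar> \<le> E u"
      using main[of u] by (cases "u = 0") (auto simp: profile_0 P_def E_def)
  qed
  then show ?thesis
    unfolding P_def E_def using u0 by blast
qed

section \<open>Logarithmic densities: no expansion in powers\<close>

text \<open>
  By the rule of L'Hopital this reduces to the quotient of
  \<open>c * level u ^ (n - 1) * ln (1 / level u) / (4 * (1 - u))\<close> and the derivative of \<open>u ^ n * ln (1 / u)\<close>. As
  \<open>level u\<close> is asymptotic to \<open>3 u / 4\<close>, the limit is the constant \<open>L\<close> of the proof.
\<close>

lemma profile_asymp_log:
  assumes n: "n \<in> {1, 2 :: nat}" and "c \<noteq> 0"
    and h: "\<And>x. 0 < x \<Longrightarrow> x < b \<Longrightarrow> h x = c * x ^ (n - 1) * ln (1 / x)"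
  shows "\<exists>L. L \<noteq> 0 \<and> ((\<lambda>u. profile \<nu> u / (u ^ n * ln (1 / u))) \<longlongrightarrow> L) (at_right 0)"
proof -
  define L where "L = c * (3/4) ^ (n - 1) / (4 * real n)"
  let ?g = "\<lambda>u::real. u ^ n * ln (1 / u)"
  let ?g' = "\<lambda>u::real. real n * u ^ (n - 1) * ln (1 / u) - u ^ (n - 1)"
  let ?f' = "\<lambda>u. h (level u) / (4 * (1 - u))"
  have "((\<lambda>u. profile \<nu> u / ?g u) \<longlongrightarrow> L) (at_right 0)"
  proof (rule lhopital_right_0[OF tendsto_profile_0, where f' = ?f' and g' = ?g'])
    show "(?g \<longlongrightarrow> 0) (at_right 0)"
      using n by (elim insertE emptyE; simp; real_asymp)
    show "eventually (\<lambda>u. ?g u \<noteq> 0) (at_right 0)"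
      using eventually_DERIV_profile by eventually_elim auto
    have "eventually (\<lambda>u::real. 1 < ln (1 / u)) (at_right 0)"
      by real_asymp
    then show "eventually (\<lambda>u. ?g' u \<noteq> 0) (at_right 0)"
      using eventually_DERIV_profile
    proof eventually_elim
      case (elim u)
      have "?g' u = u ^ (n - 1) * (real n * ln (1 / u) - 1)"
        by (simp add: algebra_simps)
      moreover have "1 * ln (1 / u) \<le> real n * ln (1 / u)"
        using n elim by (intro mult_right_mono) auto
      then have "real n * ln (1 / u) - 1 \<noteq> 0"
        using elim by linarith
      moreover have "u ^ (n - 1) \<noteq> 0"
        using elim by simp
      ultimately show ?case
        by (metis mult_eq_0_iff)
    qed
    show "eventually (\<lambda>u. (profile \<nu> has_real_derivative ?f' u) (at u)) (at_right 0)"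
      using eventually_DERIV_profile by eventually_elim auto
    show "eventually (\<lambda>u. (?g has_real_derivative ?g' u) (at u)) (at_right 0)"
      using eventually_DERIV_profile
    proof eventually_elim
      case (elim u)
      have "u ^ n = u ^ (n - 1) * u"
        using n by (auto simp: power2_eq_square)
      then have "u ^ n * (1 / (1 / u) * - (1 / u ^ 2)) = - (u ^ (n - 1))"
        using elim by (simp add: power2_eq_square)
      moreover have "(?g has_real_derivative real n * u ^ (n - 1) * ln (1 / u) + u ^ n * (1 / (1 / u) * - (1 / u ^ 2))) (at u)"
        using elim by (auto intro!: derivative_eq_intros simp: power2_eq_square)
      ultimately show ?case by simp
    qed
    have "((\<lambda>u. c * level u ^ (n - 1) * ln (1 / level u) / (4 * (1 - u)) / ?g' u) \<longlongrightarrow> L) (at_right 0)"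
    proof -
      have "((\<lambda>u. level u ^ (n - 1) * ln (1 / level u) / (4 * (1 - u)) / ?g' u) \<longlongrightarrow> (3/4) ^ (n - 1) / (4 * real n)) (at_right 0)"
        unfolding level_def using n by (elim insertE emptyE; simp; real_asymp)
      from tendsto_mult_left[OF this, of c] show ?thesis
        by (simp add: L_def mult.assoc)
    qed
    moreover have "eventually (\<lambda>u. c * level u ^ (n - 1) * ln (1 / level u) / (4 * (1 - u)) / ?g' u = ?f' u / ?g' u) (at_right 0)"
      using eventually_DERIV_profile by eventually_elim (simp add: h)
    ultimately show "((\<lambda>u. ?f' u / ?g' u) \<longlongrightarrow> L) (at_right 0)"
      by (rule Lim_transform_eventually)
  qed
  moreover have "L \<noteq> 0"
    using n \<open>c \<noteq> 0\<close> by (auto simp: L_def)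
  ultimately show ?thesis by blast
qed

end

text \<open>
  No power of \<open>s\<close> is comparable with the logarithm, so a finite sum of powers divided by
  \<open>ln (1 / s)\<close> can only converge to 0. Induction on the number of terms: if the smallest exponent is
  nonnegative, every term tends to 0. If it is negative, multiplication by \<open>s powr - \<gamma> 0 * ln (1 / s)\<close>
  turns the sum into one that tends to its first coefficient, but also to 0. So this coefficient
  vanishes and the first term can be dropped.
\<close>

lemma power_sum_over_log_limit:
  fixes a \<gamma> :: "nat \<Rightarrow> real"
  assumes "\<And>i j. i < j \<Longrightarrow> j < k \<Longrightarrow> \<gamma> i < \<gamma> j"
    and "((\<lambda>s. \<Sum>i<k. a i * (s powr \<gamma> i / ln (1 / s))) \<longlongrightarrow> L) (at_right 0)"
  shows "L = 0"
  using assms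
proof (induction k arbitrary: a \<gamma>)
  case 0
  then show ?case
    using tendsto_unique[of "at_right (0::real)" "\<lambda>_. 0" 0 L] by simp
next
  case (Suc k)
  let ?f = "\<lambda>s. \<Sum>i<Suc k. a i * (s powr \<gamma> i / ln (1 / s))"
  show ?case
  proof (cases "\<gamma> 0 < 0")
    case False
    have "\<gamma> 0 \<le> \<gamma> i" if "i < Suc k" for i
      using Suc.prems(1)[of 0 i] that by (cases "i = 0") auto
    then have "0 \<le> \<gamma> i" if "i < Suc k" for i
      using False that by force
    moreover have "((\<lambda>s. s powr g / ln (1 / s)) \<longlongrightarrow> 0) (at_right 0)" if "0 \<le> g" for g :: real
    proof (cases "g = 0")
      case True
      have "((\<lambda>s::real. s powr 0 / ln (1 / s)) \<longlongrightarrow> 0) (at_right 0)"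
        by real_asymp
      then show ?thesis using True by simp
    next
      case False
      then have "0 < g" using that by simp
      then show ?thesis by real_asymp
    qed
    ultimately have "(?f \<longlongrightarrow> 0) (at_right 0)"
      by (intro tendsto_null_sum tendsto_mult_right_zero) auto
    then show ?thesis
      using tendsto_unique[OF _ Suc.prems(2)] by simp
  next
    case True
    have nz: "eventually (\<lambda>s::real. 0 < s \<and> s < 1) (at_right 0)"
      by (auto simp: eventually_at_right_field intro!: exI[of _ 1])
    have "((\<lambda>s. s powr - \<gamma> 0 * ln (1 / s)) \<longlongrightarrow> 0) (at_right 0)"
      using True by real_asymp
    from tendsto_mult[OF this Suc.prems(2)]
    have "((\<lambda>s. (s powr - \<gamma> 0 * ln (1 / s)) * ?f s) \<longlongrightarrow> 0) (at_right 0)"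
      by simp
    moreover have "eventually (\<lambda>s. (s powr - \<gamma> 0 * ln (1 / s)) * ?f s
        = a 0 + (\<Sum>i<k. a (Suc i) * s powr (\<gamma> (Suc i) - \<gamma> 0))) (at_right 0)"
      using nz
    proof eventually_elim
      case (elim s)
      have "(s powr - \<gamma> 0 * ln (1 / s)) * ?f s = (\<Sum>i<Suc k. a i * s powr (\<gamma> i - \<gamma> 0))"
        unfolding sum_distrib_left using elim
        by (intro sum.cong) (auto simp: powr_diff powr_minus field_simps)
      then show ?case
        using elim by (simp add: sum.lessThan_Suc_shift del: sum.lessThan_Suc)
    qed
    ultimately have "((\<lambda>s. a 0 + (\<Sum>i<k. a (Suc i) * s powr (\<gamma> (Suc i) - \<gamma> 0))) \<longlongrightarrow> 0) (at_right 0)"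
      by (rule Lim_transform_eventually)
    moreover have "((\<lambda>s. a 0 + (\<Sum>i<k. a (Suc i) * s powr (\<gamma> (Suc i) - \<gamma> 0))) \<longlongrightarrow> a 0 + 0) (at_right 0)"
    proof (intro tendsto_add tendsto_const tendsto_null_sum tendsto_mult_right_zero)
      fix i assume "i \<in> {..<k}"
      then have "0 < \<gamma> (Suc i) - \<gamma> 0"
        using Suc.prems(1)[of 0 "Suc i"] by simp
      then show "((\<lambda>s. s powr (\<gamma> (Suc i) - \<gamma> 0)) \<longlongrightarrow> 0) (at_right 0)"
        by real_asymp
    qed
    ultimately have "a 0 = 0"
      using tendsto_unique[of "at_right (0::real)"] by fastforce
    then have "?f = (\<lambda>s. \<Sum>i<k. a (Suc i) * (s powr \<gamma> (Suc i) / ln (1 / s)))"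
      by (simp add: sum.lessThan_Suc_shift del: sum.lessThan_Suc)
    with Suc.prems(2) have "((\<lambda>s. \<Sum>i<k. a (Suc i) * (s powr \<gamma> (Suc i) / ln (1 / s))) \<longlongrightarrow> L) (at_right 0)"
      by simp
    then show ?thesis
      using Suc.prems(1) by (intro Suc.IH[of "\<lambda>i. \<gamma> (Suc i)"]) auto
  qed
qed

text \<open>
  The error term is negligible against \<open>s ^ n * ln (1 / s)\<close>, so that the sum of the powers alone would have the
  quotient limit \<open>L\<close>.
\<close>

lemma power_log_has_no_expansion:
  fixes f :: "real \<Rightarrow> real" and \<beta> :: "nat \<Rightarrow> real"
  assumes lim: "((\<lambda>s. f s / (s ^ n * ln (1 / s))) \<longlongrightarrow> L) (at_right 0)"
    and incr: "\<And>i j. i < j \<Longrightarrow> j < k \<Longrightarrow> \<beta> i < \<beta> j"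
    and "real n < \<beta> k" and "0 < s0"
    and approx: "\<And>s. 0 < s \<Longrightarrow> s < s0 \<Longrightarrow> \<bar>f s - (\<Sum>i<k. a i * s powr \<beta> i)\<bar> \<le> \<kappa> * s powr \<beta> k"
  shows "L = 0"
proof (rule power_sum_over_log_limit)
  let ?g = "\<lambda>s. \<Sum>i<k. a i * s powr \<beta> i"
  let ?d = "\<lambda>s. s ^ n * ln (1 / s)"
  have ev: "eventually (\<lambda>s. 0 < s \<and> s < s0 \<and> s < 1) (at_right 0)"
    using \<open>0 < s0\<close> by (auto simp: eventually_at_right_field intro!: exI[of _ "min s0 1"])
  have powr: "s powr e / ?d s = s powr (e - real n) / ln (1 / s)" if "0 < s" for s e
    using that by (simp add: powr_diff powr_realpow)
  have "((\<lambda>s. (f s - ?g s) / ?d s) \<longlongrightarrow> 0) (at_right 0)"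
  proof (rule tendsto_rabs_zero_cancel, rule tendsto_sandwich[of "\<lambda>_. 0"])
    show "eventually (\<lambda>s. \<bar>(f s - ?g s) / ?d s\<bar> \<le> \<kappa> * (s powr (\<beta> k - real n) / ln (1 / s))) (at_right 0)"
      using ev
    proof eventually_elim
      case (elim s)
      then have "0 < ?d s" by simp
      then have "\<bar>(f s - ?g s) / ?d s\<bar> = \<bar>f s - ?g s\<bar> / ?d s"
        by (simp only: abs_divide abs_of_pos)
      also have "\<dots> \<le> \<kappa> * s powr \<beta> k / ?d s"
        using approx[of s] elim \<open>0 < ?d s\<close> by (intro divide_right_mono) auto
      also have "\<dots> = \<kappa> * (s powr (\<beta> k - real n) / ln (1 / s))"
        using elim powr[of s "\<beta> k"] by (simp add: times_divide_eq_right[symmetric] del: times_divide_eq_right)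
      finally show ?case .
    qed
    have "0 < \<beta> k - real n"
      using \<open>real n < \<beta> k\<close> by simp
    then have "((\<lambda>s. s powr (\<beta> k - real n) / ln (1 / s)) \<longlongrightarrow> 0) (at_right 0)"
      by real_asymp
    then show "((\<lambda>s. \<kappa> * (s powr (\<beta> k - real n) / ln (1 / s))) \<longlongrightarrow> 0) (at_right 0)"
      by (rule tendsto_mult_right_zero)
  qed auto
  from tendsto_diff[OF lim this]
  have "((\<lambda>s. f s / ?d s - (f s - ?g s) / ?d s) \<longlongrightarrow> L) (at_right 0)"
    by simp
  moreover have "eventually (\<lambda>s. f s / ?d s - (f s - ?g s) / ?d s
      = (\<Sum>i<k. a i * (s powr (\<beta> i - real n) / ln (1 / s)))) (at_right 0)"
    using ev
  proof eventually_elim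
    case (elim s)
    have "f s / ?d s - (f s - ?g s) / ?d s = ?g s / ?d s"
      by (simp add: diff_divide_distrib)
    also have "\<dots> = (\<Sum>i<k. a i * (s powr \<beta> i / ?d s))"
      by (simp add: sum_divide_distrib)
    finally show ?case
      using powr elim by simp
  qed
  ultimately show "((\<lambda>s. \<Sum>i<k. a i * (s powr (\<beta> i - real n) / ln (1 / s))) \<longlongrightarrow> L) (at_right 0)"
    by (rule Lim_transform_eventually)
qed (use incr in auto)

section \<open>Essential uniqueness of the conditional distribution function\<close>

lemma right_continuous_eq_if_eq_on_Rats:
  fixes f g :: "real \<Rightarrow> real"
  assumes "continuous (at_right s) f" "continuous (at_right s) g" "s < b"
    and eq: "\<And>r. r \<in> \<rat> \<Longrightarrow> s < r \<Longrightarrow> r < b \<Longrightarrow> f r = g r"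
  shows "f s = g s"
proof (rule ccontr)
  assume "f s \<noteq> g s"
  have "((\<lambda>r. f r - g r) \<longlongrightarrow> f s - g s) (at_right s)"
    using assms(1,2) by (intro tendsto_diff) (auto simp: continuous_within)
  then have "eventually (\<lambda>r. f r - g r \<noteq> 0) (at_right s)"
    by (rule tendsto_imp_eventually_ne) (use \<open>f s \<noteq> g s\<close> in simp)
  then obtain c where "s < c" and c: "\<And>r. s < r \<Longrightarrow> r < c \<Longrightarrow> f r - g r \<noteq> 0"
    by (auto simp: eventually_at_right_field)
  obtain r where "r \<in> \<rat>" "s < r" "r < min b c"
    using Rats_dense_in_real[of s "min b c"] \<open>s < c\<close> \<open>s < b\<close> by auto
  then show False
    using eq[of r] c[of r] by auto
qed

text \<open>
  For each \<open>s\<close> two versions agree almost everywhere. The exceptional null set can be chosen independently of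
  \<open>s\<close> by using the countably many rational \<open>s\<close> first and right continuity afterwards.
\<close>

lemma AE_cond_cdf_versions_agree:
  assumes G: "cond_cdf_version \<mu> G" and G': "cond_cdf_version \<mu> G'"
  shows "AE p in \<mu>. Z_stat p \<in> {0..3} \<longrightarrow> (\<forall>s\<in>{0..<1}. G (Z_stat p) s = G' (Z_stat p) s)"
proof -
  have "AE p in \<mu>. \<forall>r\<in>\<rat> \<inter> {0..1}. G (Z_stat p) r = G' (Z_stat p) r"
  proof (subst AE_ball_countable)
    show "countable (\<rat> \<inter> {0..1::real})"
      by (rule countable_Int1[OF countable_rat])
    show "\<forall>r\<in>\<rat> \<inter> {0..1}. AE p in \<mu>. G (Z_stat p) r = G' (Z_stat p) r"
    proof
      fix r :: real assume "r \<in> \<rat> \<inter> {0..1}"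
      then have "AE p in \<mu>. G (Z_stat p) r = real_cond_exp \<mu> (vimage_algebra (space \<mu>) Z_stat borel) (indicator {p. S_stat p \<le> r}) p"
        and "AE p in \<mu>. G' (Z_stat p) r = real_cond_exp \<mu> (vimage_algebra (space \<mu>) Z_stat borel) (indicator {p. S_stat p \<le> r}) p"
        using G G' by (auto simp: cond_cdf_version_def)
      then show "AE p in \<mu>. G (Z_stat p) r = G' (Z_stat p) r"
        by eventually_elim simp
    qed
  qed
  then show ?thesis
  proof eventually_elim
    case (elim p)
    show ?case
    proof (intro impI ballI)
      fix s :: real assume p: "Z_stat p \<in> {0..3}" and s: "s \<in> {0..<1}"
      show "G (Z_stat p) s = G' (Z_stat p) s"
      proof (rule right_continuous_eq_if_eq_on_Rats[of s "G (Z_stat p)" "G' (Z_stat p)" 1])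
        show "continuous (at_right s) (G (Z_stat p))" "continuous (at_right s) (G' (Z_stat p))"
          using G G' p s unfolding cond_cdf_version_def by blast+
        show "G (Z_stat p) r = G' (Z_stat p) r" if "r \<in> \<rat>" "s < r" "r < 1" for r
          using elim that s by auto
      qed (use s in auto)
    qed
  qed
qed

context real_distribution
begin

lemma emeasure_law_Times:
  assumes "A \<in> sets borel" "B \<in> sets borel"
  shows "emeasure (exterior_law \<Otimes>\<^sub>M M) (A \<times> B) = emeasure exterior_law A * emeasure M B"
  using assms by (intro emeasure_pair_measure_Times) auto

text \<open>
  At \<open>te = t\<close> and \<open>ti = 0\<close> the statistic \<open>Z\<close> takes the value \<open>3 exp (- 4 t)\<close>. By continuity a small box at this
  point is mapped into the neighbourhood, and it has positive probability.
\<close>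

lemma emeasure_Z_neighbourhood_pos:
  assumes pos: "\<And>a. 0 < a \<Longrightarrow> 0 < prob {0..a}"
    and "0 < t" "open J" "3 * exp (- 4 * t) \<in> J"
  shows "0 < emeasure (exterior_law \<Otimes>\<^sub>M M) {p. Z_stat p \<in> J}"
proof -
  have cont: "continuous_on UNIV Z_stat"
    unfolding Z_stat_def case_prod_beta by (intro continuous_intros)
  have "open (Z_stat -` J)"
    using \<open>open J\<close> cont by (intro open_vimage)
  moreover have "(t, 0) \<in> Z_stat -` J"
    using assms by (simp add: Z_stat_def mult.commute)
  ultimately obtain A B where AB: "open A" "open B" "(t, 0) \<in> A \<times> B" "A \<times> B \<subseteq> Z_stat -` J"
    by (rule open_prod_elim)
  obtain d1 where d1: "0 < d1" "cball t d1 \<subseteq> A"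
    using AB open_contains_cball[of A] by auto
  obtain d2 where d2: "0 < d2" "cball 0 d2 \<subseteq> B"
    using AB open_contains_cball[of B] by auto
  have "0 < ennreal (4 * exp (- 4 * (t + d1)) * d1)"
    using d1 by simp
  also have "\<dots> \<le> emeasure exterior_law {t..t + d1}"
    using d1 \<open>0 < t\<close> by (intro emeasure_exterior_law_ge) auto
  finally have "0 < emeasure exterior_law {t..t + d1} * emeasure M {0..d2}"
    using pos[OF d2(1)] by (simp add: emeasure_eq_measure ennreal_zero_less_mult_iff)
  also have "\<dots> = emeasure (exterior_law \<Otimes>\<^sub>M M) ({t..t + d1} \<times> {0..d2})"
    by (simp add: emeasure_law_Times)
  also have "\<dots> \<le> emeasure (exterior_law \<Otimes>\<^sub>M M) {p. Z_stat p \<in> J}"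
  proof (rule emeasure_mono)
    have "{t..t + d1} \<subseteq> cball t d1" "{0..d2} \<subseteq> cball 0 d2"
      by (auto simp: dist_real_def)
    then show "{t..t + d1} \<times> {0..d2} \<subseteq> {p. Z_stat p \<in> J}"
      using d1(2) d2(2) AB(4) by blast
    have "Z_stat -` J \<inter> space (borel \<Otimes>\<^sub>M borel) \<in> sets (borel \<Otimes>\<^sub>M borel)"
      using \<open>open J\<close> by (intro measurable_sets[OF Z_stat_measurable]) auto
    moreover have "sets (exterior_law \<Otimes>\<^sub>M M) = sets (borel \<Otimes>\<^sub>M borel)"
      by (intro sets_pair_measure_cong) auto
    moreover have "Z_stat -` J \<inter> space (borel \<Otimes>\<^sub>M borel) = {p. Z_stat p \<in> J}"
      by (auto simp: space_pair_measure)
    ultimately show "{p. Z_stat p \<in> J} \<in> sets (exterior_law \<Otimes>\<^sub>M M)"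
      by simp
  qed
  finally show ?thesis .
qed

text \<open>
  A suitable outcome in the neighbourhood of \<open>4 q\<^sub>0 - 1\<close> provides a single \<open>z\<close> at which the given version
  coincides with the explicit one for all \<open>s < 1\<close>. At this \<open>z\<close>, the expansion in \<open>s\<close> would be one
  of a function asymptotic to a nonzero multiple of \<open>s ^ n * ln (1 / s)\<close>.
\<close>

lemma not_small_s_expansion:
  assumes pos: "\<And>a. 0 < a \<Longrightarrow> 0 < prob {0..a}"
    and lim: "((\<lambda>u. profile M u / (u ^ n * ln (1 / u))) \<longlongrightarrow> L) (at_right 0)" "L \<noteq> 0" "n \<le> 2"
    and G: "cond_cdf_version (exterior_law \<Otimes>\<^sub>M M) G" and "0 < t"
  shows "\<not> small_s_expansion G t"
proof
  assume "small_s_expansion G t"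
  then obtain s0 I k \<alpha> \<kappa> \<epsilon> F where
    s0: "0 < s0" "s0 \<le> 1" and I: "I \<subseteq> {0<..<3}" "4 * q0 t - 1 \<in> interior I" and "0 < \<alpha>"
    and \<epsilon>: "\<forall>i<k. \<epsilon> i < \<epsilon> (Suc i)" "2 < \<epsilon> k"
    and approx: "\<forall>s\<in>{0..s0}. \<forall>z\<in>I.
      \<bar>G z s - (\<Sum>i<k. F i z * s powr (\<alpha> + \<epsilon> i))\<bar> \<le> \<kappa> * s powr (\<alpha> + \<epsilon> k)"
    unfolding small_s_expansion_def by blast
  let ?\<mu> = "exterior_law \<Otimes>\<^sub>M M"
  let ?N = "{p. Z_stat p \<in> interior I}"
  have "3 * exp (- 4 * t) \<in> interior I"
    using I(2) by (simp add: q0_def add_divide_distrib)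
  then have N: "0 < emeasure ?\<mu> ?N"
    using pos \<open>0 < t\<close> by (intro emeasure_Z_neighbourhood_pos) auto
  have "\<not> (AE p in ?\<mu>. p \<notin> ?N)"
  proof
    assume "AE p in ?\<mu>. p \<notin> ?N"
    moreover have "?N \<in> sets ?\<mu>"
      using N emeasure_notin_sets by fastforce
    ultimately have "emeasure ?\<mu> ?N = 0"
      by (subst (asm) AE_iff_measurable[of ?N]) (auto simp: space_pair_measure)
    with N show False by simp
  qed
  then have "\<exists>p. Z_stat p \<in> interior I \<and>
      (Z_stat p \<in> {0..3} \<longrightarrow> (\<forall>s\<in>{0..<1}. G (Z_stat p) s = cond_cdf M (Z_stat p) s))"
  proof (rule contrapos_np)
    assume none: "\<not> (\<exists>p. Z_stat p \<in> interior I \<and>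
      (Z_stat p \<in> {0..3} \<longrightarrow> (\<forall>s\<in>{0..<1}. G (Z_stat p) s = cond_cdf M (Z_stat p) s)))"
    show "AE p in ?\<mu>. p \<notin> ?N"
      using AE_cond_cdf_versions_agree[OF G cond_cdf_version_cond_cdf]
      by eventually_elim (use none in blast)
  qed
  then obtain p where p: "Z_stat p \<in> interior I"
    and agree: "Z_stat p \<in> {0..3} \<longrightarrow> (\<forall>s\<in>{0..<1}. G (Z_stat p) s = cond_cdf M (Z_stat p) s)"
    by blast
  define z where "z = Z_stat p"
  have z: "z \<in> I" "0 < z" "z < 3"
    using p I(1) interior_subset[of I] by (auto simp: z_def)
  have Gz: "G z s = cond_cdf M z s" if "0 \<le> s" "s < 1" for s
    using agree z that by (auto simp: z_def)
  have Z_density: "0 < Z_density M z"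
    using pos z by (intro Z_density_pos) auto
  define f where "f = (\<lambda>s. profile M (s / z) / Z_density M z)"
  define s1 where "s1 = min (min s0 z) ((3 - z) / 2)"
  have s1: "0 < s1"
    using s0 z by (auto simp: s1_def)
  have f: "f s = G z s" if "0 < s" "s < s1" for s
    using that z Z_density s0 by (simp add: f_def Gz cond_cdf_eq_profile s1_def)
  have \<epsilon>_less: "\<epsilon> i < \<epsilon> j" if "i < j" "j < k" for i j
    using that
  proof (induction rule: strict_inc_induct)
    case (step i)
    then have "\<epsilon> i < \<epsilon> (Suc i)"
      using \<epsilon>(1) by auto
    with step show ?case by simp
  qed (use \<epsilon>(1) in auto)
  have "L * (1 / (z ^ n * Z_density M z)) = 0"
  proof (rule power_log_has_no_expansion[where \<beta> = "\<lambda>i. \<alpha> + \<epsilon> i" and k = k and a = "\<lambda>i. F i z" and \<kappa> = \<kappa>])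
    \<comment> \<open>Replacing \<open>s / z\<close> by \<open>s\<close> in the denominator changes the limit by the factor \<open>1 / z ^ n\<close> only, because
      \<open>ln (z / s)\<close> and \<open>ln (1 / s)\<close> are asymptotically equal.\<close>
    have "filterlim (\<lambda>s. s / z) (at_right 0) (at_right 0)"
      using z by real_asymp
    from filterlim_compose[OF lim(1) this]
    have "((\<lambda>s. profile M (s / z) / ((s / z) ^ n * ln (1 / (s / z)))) \<longlongrightarrow> L) (at_right 0)" .
    moreover have "((\<lambda>s. ln (1 / (s / z)) / ln (1 / s)) \<longlongrightarrow> 1) (at_right 0)"
      using z by real_asymp
    moreover have "((\<lambda>s::real. 1 / (z ^ n * Z_density M z)) \<longlongrightarrow> 1 / (z ^ n * Z_density M z)) (at_right 0)"
      by simp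
    ultimately have "((\<lambda>s. profile M (s / z) / ((s / z) ^ n * ln (1 / (s / z)))
        * ((ln (1 / (s / z)) / ln (1 / s)) * (1 / (z ^ n * Z_density M z)))) \<longlongrightarrow> L * (1 * (1 / (z ^ n * Z_density M z)))) (at_right 0)"
      by (intro tendsto_mult)
    moreover have "eventually (\<lambda>s. profile M (s / z) / ((s / z) ^ n * ln (1 / (s / z)))
        * ((ln (1 / (s / z)) / ln (1 / s)) * (1 / (z ^ n * Z_density M z))) = f s / (s ^ n * ln (1 / s))) (at_right 0)"
    proof -
      have "eventually (\<lambda>s. 0 < s \<and> s < z) (at_right 0)"
        using z by (auto simp: eventually_at_right_field)
      then show ?thesis
      proof eventually_elim
        case (elim s)
        then have "ln (1 / (s / z)) \<noteq> 0"
          by simp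
        then show ?case
          using z Z_density elim unfolding f_def power_divide by (simp del: ln_div ln_eq_zero_iff divide_divide_eq_right)
      qed
    qed
    ultimately show "((\<lambda>s. f s / (s ^ n * ln (1 / s))) \<longlongrightarrow> L * (1 / (z ^ n * Z_density M z))) (at_right 0)"
      using Lim_transform_eventually by fastforce
    show "real n < \<alpha> + \<epsilon> k"
      using \<open>n \<le> 2\<close> \<open>0 < \<alpha>\<close> \<epsilon>(2) by linarith
    show "\<bar>f s - (\<Sum>i<k. F i z * s powr (\<alpha> + \<epsilon> i))\<bar> \<le> \<kappa> * s powr (\<alpha> + \<epsilon> k)" if "0 < s" "s < s1" for s
      using approx z that by (simp add: f s1_def)
  qed (use s1 \<epsilon>_less in auto)
  then show False
    using \<open>L \<noteq> 0\<close> z Z_density by simp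
qed

section \<open>The local probabilities, and laws that are not tame\<close>

lemma Q_prob_law:
  "Q_prob (exterior_law \<Otimes>\<^sub>M M) n t = measure exterior_law {t..t + 1 / real n} * prob {..1 / real n}"
proof -
  have "{(te, ti). ti \<le> 1 / real n \<and> t \<le> te \<and> te \<le> t + 1 / real n} = {t..t + 1 / real n} \<times> {..1 / real n}"
    by auto
  then show ?thesis
    unfolding Q_prob_def by (simp add: measure_def emeasure_law_Times enn2real_mult)
qed

text \<open>
  The exterior factor of \<open>Q\<^sub>n(t)\<close> is at least of order \<open>1 / n\<close>, as its density is bounded below on
  \<open>[t, t + 1]\<close>, and the interior factor at least \<open>c / n\<close>. Hence \<open>Q\<^sub>n(t)\<close> lies between a multiple of \<open>1 / n\<^sup>2\<close> and 1, and its logarithm is \<open>O(log n)\<close>.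
\<close>

lemma Q_prob_subexponential:
  assumes "0 < c" and ge: "eventually (\<lambda>n. c / real n \<le> prob {..1 / real n}) sequentially" and "0 < t"
  shows "eventually (\<lambda>n. 0 < Q_prob (exterior_law \<Otimes>\<^sub>M M) n t) sequentially"
    and "(\<lambda>n. ln (Q_prob (exterior_law \<Otimes>\<^sub>M M) n t) / real n) \<longlonglongrightarrow> 0"
proof -
  interpret E: prob_space exterior_law
    by (rule prob_space_exterior_law)
  let ?Q = "\<lambda>n. Q_prob (exterior_law \<Otimes>\<^sub>M M) n t"
  define c' where "c' = 4 * exp (- 4 * (t + 1)) * c"
  have c': "0 < c'"
    using \<open>0 < c\<close> by (simp add: c'_def)
  have ev: "eventually (\<lambda>n. 0 < n \<and> c' / real n ^ 2 \<le> ?Q n \<and> ?Q n \<le> 1) sequentially"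
    using ge eventually_gt_at_top[of 0]
  proof eventually_elim
    case (elim n)
    have "exp (- 4 * (t + 1)) \<le> exp (- 4 * (t + 1 / real n))"
      using elim by (simp add: divide_le_eq)
    then have "4 * exp (- 4 * (t + 1)) * (1 / real n) \<le> 4 * exp (- 4 * (t + 1 / real n)) * (1 / real n)"
      using elim by (intro mult_right_mono mult_left_mono) auto
    also have "\<dots> \<le> measure exterior_law {t..t + 1 / real n}"
      using emeasure_exterior_law_ge[of t "1 / real n"] \<open>0 < t\<close> by (simp add: E.emeasure_eq_measure)
    finally have "4 * exp (- 4 * (t + 1)) * (1 / real n) * (c / real n) \<le> ?Q n"
      unfolding Q_prob_law using elim \<open>0 < c\<close> by (intro mult_mono) auto
    moreover have "?Q n \<le> 1"
      unfolding Q_prob_law by (intro mult_le_one) auto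
    ultimately show ?case
      using elim by (simp add: c'_def power2_eq_square)
  qed
  show "eventually (\<lambda>n. 0 < ?Q n) sequentially"
    using ev
  proof eventually_elim
    case (elim n)
    then have "0 < c' / real n ^ 2"
      using c' by simp
    with elim show ?case by linarith
  qed
  show "(\<lambda>n. ln (?Q n) / real n) \<longlonglongrightarrow> 0"
  proof (rule tendsto_sandwich)
    show "eventually (\<lambda>n. ln (c' / real n ^ 2) / real n \<le> ln (?Q n) / real n) sequentially"
      using ev
    proof eventually_elim
      case (elim n)
      then have "0 < c' / real n ^ 2"
        using c' by simp
      with elim show ?case
        by (intro divide_right_mono) (auto simp: ln_le_cancel_iff simp del: ln_div)
    qed
    show "eventually (\<lambda>n. ln (?Q n) / real n \<le> 0) sequentially"
      using ev
    proof eventually_elim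
      case (elim n)
      then have "0 < c' / real n ^ 2"
        using c' by simp
      with elim have "ln (?Q n) \<le> 0"
        by (subst ln_le_zero_iff) linarith+
      then show ?case
        by (intro divide_nonpos_nonneg) auto
    qed
    show "(\<lambda>n. ln (c' / real n ^ 2) / real n) \<longlonglongrightarrow> 0"
      using c' by real_asymp
  qed simp
qed

text \<open>
  An everywhere positive density gives positive mass to the box \<open>[0, 1] \<times> [b, b + 1]\<close>. The
  smoothness of the density provides the measurability that turns this mass into an integral.
\<close>

lemma not_tame_law:
  assumes null: "prob {b..b + 1} = 0" and "0 \<le> b"
  shows "\<not> tame (exterior_law \<Otimes>\<^sub>M M)"
proof
  assume "tame (exterior_law \<Otimes>\<^sub>M M)"
  then obtain f where law: "exterior_law \<Otimes>\<^sub>M M = density lborel (\<lambda>x. ennreal (f x) * indicator quadrant x)"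
    and smooth: "smooth_on_set quadrant f" and f: "\<forall>x\<in>quadrant. 0 \<le> f x \<and> f x \<noteq> 0"
    unfolding tame_def by blast
  obtain U g where "open U" "quadrant \<subseteq> U" and g: "\<forall>k. C_k_on k U g" "\<forall>x\<in>quadrant. g x = f x"
    using smooth unfolding smooth_on_set_def by blast
  have "continuous_on quadrant f"
  proof (rule continuous_on_eq)
    show "continuous_on quadrant g"
      using g(1)[rule_format, of 0] \<open>quadrant \<subseteq> U\<close> by (auto intro: continuous_on_subset)
  qed (use g(2) in simp)
  moreover have quadrant [measurable]: "quadrant \<in> sets borel"
    unfolding quadrant_def by (intro borel_closed closed_Times) auto
  ultimately have "(\<lambda>x. indicator quadrant x *\<^sub>R f x) \<in> borel_measurable borel"
    by (intro borel_measurable_continuous_on_indicator) auto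
  then have "(\<lambda>x. ennreal (indicator quadrant x *\<^sub>R f x)) \<in> borel_measurable borel"
    by measurable
  also have "(\<lambda>x. ennreal (indicator quadrant x *\<^sub>R f x)) = (\<lambda>x. ennreal (f x) * indicator quadrant x)"
    by (auto split: split_indicator)
  finally have [measurable]: "(\<lambda>x. ennreal (f x) * indicator quadrant x) \<in> borel_measurable borel" .
  let ?B = "{0..1::real} \<times> {b..b + 1}"
  have [measurable]: "?B \<in> sets borel"
    by (intro borel_closed closed_Times) auto
  have B: "?B \<subseteq> quadrant"
    using \<open>0 \<le> b\<close> by (auto simp: quadrant_def)
  have "(\<integral>\<^sup>+x. ennreal (f x) * indicator quadrant x * indicator ?B x \<partial>lborel) = emeasure (exterior_law \<Otimes>\<^sub>M M) ?B"
    unfolding law by (simp add: emeasure_density)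
  also have "\<dots> = 0"
    using null by (simp add: emeasure_law_Times emeasure_eq_measure)
  finally have "AE x in lborel. ennreal (f x) * indicator quadrant x * indicator ?B x = 0"
    by (subst (asm) nn_integral_0_iff_AE) auto
  then have "AE x in lborel. x \<notin> ?B"
  proof eventually_elim
    case (elim x)
    show ?case
    proof
      assume "x \<in> ?B"
      with elim f B show False
        by (auto simp: ennreal_eq_0_iff dest!: subsetD[OF B])
    qed
  qed
  then have "emeasure lborel ?B = 0"
    by (subst (asm) AE_iff_measurable[of ?B]) auto
  moreover have "emeasure lborel ?B = emeasure lborel {0..1::real} * emeasure lborel {b..b + 1}"
    unfolding lborel_prod[symmetric] by (intro lborel.emeasure_pair_measure_Times) auto
  ultimately show False
    by simp
qed

end

section \<open>Tempered and not tempered laws\<close>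

context interior_density
begin

lemma emeasure_density_Icc: "emeasure \<nu> {x..y} = (\<integral>\<^sup>+v. ennreal (h v) * indicator {x..y} v \<partial>lborel)"
  by (simp add: emeasure_density)

lemma prob_pos:
  assumes h_pos: "\<And>x. 0 < x \<Longrightarrow> x < b \<Longrightarrow> 0 < h x" and "0 < a"
  shows "0 < prob {0..a}"
proof (rule ccontr)
  assume "\<not> 0 < prob {0..a}"
  then have "prob {0..a} = 0"
    using measure_nonneg[of \<nu> "{0..a}"] by linarith
  then have "(\<integral>\<^sup>+v. ennreal (h v) * indicator {0..a} v \<partial>lborel) = 0"
    using emeasure_density_Icc[of 0 a] emeasure_eq_measure[of "{0..a}"] by simp
  then have "AE v in lborel. ennreal (h v) * indicator {0..a} v = 0"
    by (subst (asm) nn_integral_0_iff_AE) auto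
  then have "AE v in lborel. v \<notin> {0<..<min a b}"
    by eventually_elim (use h_pos in \<open>force split: split_indicator_asm\<close>)
  then have "emeasure lborel {0<..<min a b} = 0"
    by (subst (asm) AE_iff_measurable[of "{0<..<min a b}"]) auto
  then show False
    using \<open>0 < a\<close> b_pos by (auto simp: emeasure_lborel_Ioo)
qed

lemma not_tame: "\<not> tame (exterior_law \<Otimes>\<^sub>M \<nu>)"
proof (rule not_tame_law)
  have "emeasure \<nu> {b + 1..b + 1 + 1} = 0"
    unfolding emeasure_density_Icc by (intro nn_integral_zero' AE_I2) (auto simp: h_large split: split_indicator)
  then show "prob {b + 1..b + 1 + 1} = 0"
    by (simp add: measure_def)
qed (use b_pos in auto)

theorem tempered_of_power_density:
  assumes h: "\<And>x. 0 < x \<Longrightarrow> x < b \<Longrightarrow> h x = c * x powr (\<theta> - 1)" and "0 < c" "0 < \<theta>" "\<theta> \<le> 1"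
  shows "tempered (exterior_law \<Otimes>\<^sub>M \<nu>)"
proof -
  have pos: "0 < prob {0..a}" if "0 < a" for a
    using that h \<open>0 < c\<close> by (intro prob_pos) auto
  obtain u0 d K where "0 < u0" "u0 < 1"
    and exp: "\<forall>u\<in>{0..u0}. \<bar>profile \<nu> u - (\<Sum>i<3. d i * u powr (\<theta> + real i))\<bar> \<le> K * u powr (\<theta> + 3)"
    using profile_expansion[OF h \<open>0 < \<theta>\<close>] by auto
  have "small_s_expansion (cond_cdf \<nu>) t" if "0 < t" for t
    using small_s_expansion_cond_cdf[OF pos \<open>0 < u0\<close> \<open>u0 < 1\<close> \<open>0 < \<theta>\<close> bspec[OF exp] that] .
  moreover have "0 < c * b powr (\<theta> - 1)"
    using \<open>0 < c\<close> b_pos by simp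
  moreover have "eventually (\<lambda>n. c * b powr (\<theta> - 1) / real n \<le> prob {..1 / real n}) sequentially"
  proof -
    have "eventually (\<lambda>n. 1 / real n < b) sequentially"
      using b_pos by real_asymp
    then show ?thesis
      using eventually_gt_at_top[of 0]
    proof eventually_elim
      case (elim n)
      let ?c = "c * b powr (\<theta> - 1)" and ?a = "1 / real n"
      \<comment> \<open>For \<open>\<theta> \<le> 1\<close> the density is nonincreasing, hence at least its limit at \<open>b\<close>.\<close>
      have ge: "?c \<le> h x" if "0 < x" "x \<le> ?a" for x
        using that elim h[of x] \<open>0 < c\<close> \<open>\<theta> \<le> 1\<close> by (auto intro!: powr_mono2')
      have "ennreal (?c * ?a) = (\<integral>\<^sup>+x. ennreal ?c * indicator {0<..?a} x \<partial>lborel)"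
        using elim \<open>0 < c\<close> by (simp add: nn_integral_cmult_indicator ennreal_mult[symmetric])
      also have "\<dots> \<le> (\<integral>\<^sup>+x. ennreal (h x) * indicator {..?a} x \<partial>lborel)"
        using ge by (intro nn_integral_mono) (auto split: split_indicator intro!: ennreal_leI)
      also have "\<dots> = ennreal (prob {..?a})"
        by (simp add: emeasure_density emeasure_eq_measure[symmetric])
      finally show ?case
        by simp
    qed
  qed
  ultimately show ?thesis
    unfolding tempered_def using cond_cdf_version_cond_cdf Q_prob_subexponential by blast
qed

theorem not_tempered_of_log_density:
  assumes h: "\<And>x. 0 < x \<Longrightarrow> x < b \<Longrightarrow> h x = c * x ^ (n - 1) * ln (1 / x)"
    and "0 < c" "n \<in> {1, 2}" "b \<le> 1"
  shows "\<not> tempered (exterior_law \<Otimes>\<^sub>M \<nu>)"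
proof
  assume "tempered (exterior_law \<Otimes>\<^sub>M \<nu>)"
  then obtain G where G: "cond_cdf_version (exterior_law \<Otimes>\<^sub>M \<nu>) G" "small_s_expansion G 1"
    unfolding tempered_def by auto
  have pos: "0 < prob {0..a}" if "0 < a" for a
    using that h \<open>0 < c\<close> \<open>b \<le> 1\<close> by (intro prob_pos) (auto intro!: mult_pos_pos ln_gt_zero)
  obtain L where L: "L \<noteq> 0" "((\<lambda>u. profile \<nu> u / (u ^ n * ln (1 / u))) \<longlongrightarrow> L) (at_right 0)"
    using profile_asymp_log[OF \<open>n \<in> {1, 2}\<close> _ h] \<open>0 < c\<close> by auto
  have "n \<le> 2"
    using \<open>n \<in> {1, 2}\<close> by auto
  then show False
    using not_small_s_expansion[OF pos L(2,1) _ G(1), of 1] G(2) by simp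
qed

end

lemma law_eq_exterior_law_times:
  fixes M :: "'a measure" and Te Ti :: "'a \<Rightarrow> real"
  assumes "prob_space M"
    and Te: "distributed M lborel Te (\<lambda>t. ennreal (4 * exp (- 4 * t) * indicator {0..} t))"
    and indep: "prob_space.indep_var M borel Te borel Ti"
    and Ti: "distr M borel Ti = density lborel (\<lambda>x. ennreal (h x))"
  shows "distr M borel (\<lambda>\<omega>. (Te \<omega>, Ti \<omega>)) = exterior_law \<Otimes>\<^sub>M density lborel (\<lambda>x. ennreal (h x))"
proof -
  interpret prob_space M by fact
  have "distr M borel Te = distr M lborel Te"
    by (intro distr_cong) auto
  also have "\<dots> = density lborel (\<lambda>t. ennreal (4 * exp (- 4 * t) * indicator {0..} t))"
    using Te by (rule distributed_distr_eq_density)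
  also have "(\<lambda>t. ennreal (4 * exp (- 4 * t) * indicator {0..} t)) = (\<lambda>t. ennreal (exponential_density 4 t))"
    by (auto simp: exponential_density_def mult.commute split: split_indicator)
  finally have "distr M borel Te = exterior_law" .
  moreover have "distr M borel (\<lambda>\<omega>. (Te \<omega>, Ti \<omega>)) = distr M borel Te \<Otimes>\<^sub>M distr M borel Ti"
    using indep unfolding indep_var_distribution_eq by (simp add: borel_prod)
  ultimately show ?thesis
    by (simp add: Ti)
qed

lemma interior_density_law:
  fixes M :: "'a measure"
  assumes "prob_space M" "Ti \<in> borel_measurable M"
    and Ti: "distr M borel Ti = density lborel (\<lambda>x. ennreal (f x * indicator {0..b} x))"
    and f: "f \<in> borel_measurable borel" "\<And>x. 0 \<le> x \<Longrightarrow> x \<le> b \<Longrightarrow> 0 \<le> f x" "continuous_on {0<..<b} f"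
    and "0 < b"
  shows "interior_density (\<lambda>x. f x * indicator {0..b} x) b"
proof (rule interior_density.intro)
  have "continuous_on {0<..<b} (\<lambda>x. f x * indicator {0..b} x)"
    using f(3) by (rule continuous_on_eq) auto
  then show "isCont (\<lambda>x. f x * indicator {0..b} x) x" if "0 < x" "x < b" for x
    using that by (simp add: continuous_on_eq_continuous_at)
  show "prob_space (density lborel (\<lambda>x. ennreal (f x * indicator {0..b} x)))"
    unfolding Ti[symmetric] using assms by (intro prob_space.prob_space_distr) auto
qed (use assms in \<open>auto split: split_indicator\<close>)

theorem proposition2p8:
  fixes M :: "'a measure" and Te Ti :: "'a \<Rightarrow> real"
  assumes "prob_space M"
    and "distributed M lborel Te (\<lambda>t. ennreal (4 * exp (- 4 * t) * indicator {0..} t))"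
    and "Ti \<in> borel_measurable M"
    and "prob_space.indep_var M borel Te borel Ti"
  defines "law \<equiv> distr M borel (\<lambda>\<omega>. (Te \<omega>, Ti \<omega>))"
  shows "(\<forall>\<theta>>0. distr M borel Ti = uniform_measure lborel {0..\<theta>} \<longrightarrow>
            tempered law \<and> \<not> tame law) \<and>
         (\<forall>\<theta>. 0 < \<theta> \<and> \<theta> < 1 \<and>
            distributed M lborel Ti (\<lambda>x. ennreal (\<theta> * x powr (\<theta> - 1) * indicator {0..1} x)) \<longrightarrow>
            tempered law \<and> \<not> tame law) \<and>
         (distributed M lborel Ti (\<lambda>x. ennreal (ln (1 / x) * indicator {0..1} x)) \<longrightarrow>
            \<not> tempered law) \<and>
         (distributed M lborel Ti (\<lambda>x. ennreal (4 * x * ln (1 / x) * indicator {0..1} x)) \<longrightarrow>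
            \<not> tempered law)"
proof -
  have law: "law = exterior_law \<Otimes>\<^sub>M density lborel (\<lambda>x. ennreal (h x))"
    if "distr M borel Ti = density lborel (\<lambda>x. ennreal (h x))" for h
    unfolding law_def using assms that by (intro law_eq_exterior_law_times) auto
  have distr: "distr M borel Ti = density lborel (\<lambda>x. ennreal (h x))"
    if "distributed M lborel Ti (\<lambda>x. ennreal (h x))" for h
  proof -
    have "distr M borel Ti = distr M lborel Ti"
      by (intro distr_cong) auto
    then show ?thesis
      using distributed_distr_eq_density[OF that] by simp
  qed
  note dens = interior_density_law[OF assms(1,3)]
  have "tempered law \<and> \<not> tame law"
    if "0 < \<theta>" and unif: "distr M borel Ti = uniform_measure lborel {0..\<theta>}" for \<theta>
  proof -
    have Ti: "distr M borel Ti = density lborel (\<lambda>x. ennreal (1 / \<theta> * indicator {0..\<theta>} x))"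
      unfolding unif uniform_measure_def using \<open>0 < \<theta>\<close>
      by (intro density_cong AE_I2) (auto split: split_indicator simp: ennreal_1[symmetric] divide_ennreal simp del: ennreal_1)
    \<comment> \<open>A uniform density is a power density with exponent \<open>1 - 1 = 0\<close>.\<close>
    interpret interior_density "\<lambda>x. 1 / \<theta> * indicator {0..\<theta>} x" \<theta>
      by (rule dens[OF Ti]) (use \<open>0 < \<theta>\<close> in auto)
    show ?thesis
      unfolding law[OF Ti] using \<open>0 < \<theta>\<close>
      by (intro conjI not_tame tempered_of_power_density[where c = "1 / \<theta>" and \<theta> = 1]) auto
  qed
  moreover have "tempered law \<and> \<not> tame law"
    if \<theta>: "0 < \<theta>" "\<theta> < 1"
      and d: "distributed M lborel Ti (\<lambda>x. ennreal (\<theta> * x powr (\<theta> - 1) * indicator {0..1} x))" for \<theta>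
  proof -
    interpret interior_density "\<lambda>x. \<theta> * x powr (\<theta> - 1) * indicator {0..1} x" 1
      by (rule dens[OF distr[OF d]]) (use \<theta> in \<open>auto intro!: continuous_intros\<close>)
    show ?thesis
      unfolding law[OF distr[OF d]] using \<theta>
      by (intro conjI not_tame tempered_of_power_density[where c = \<theta> and \<theta> = \<theta>]) auto
  qed
  moreover have "\<not> tempered law"
    if d: "distributed M lborel Ti (\<lambda>x. ennreal (ln (1 / x) * indicator {0..1} x))"
  proof -
    interpret interior_density "\<lambda>x. ln (1 / x) * indicator {0..1} x" 1
    proof (rule dens[OF distr[OF d]])
      show "0 \<le> ln (1 / x)" if "0 \<le> x" "x \<le> 1" for x :: real
        using that by (cases "x = 0") (auto simp: ln_div)
    qed (auto intro!: continuous_intros)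
    show ?thesis
      unfolding law[OF distr[OF d]]
      by (rule not_tempered_of_log_density[where c = 1 and n = 1]) auto
  qed
  moreover have "\<not> tempered law"
    if d: "distributed M lborel Ti (\<lambda>x. ennreal (4 * x * ln (1 / x) * indicator {0..1} x))"
  proof -
    interpret interior_density "\<lambda>x. 4 * x * ln (1 / x) * indicator {0..1} x" 1
    proof (rule dens[OF distr[OF d]])
      show "0 \<le> 4 * x * ln (1 / x)" if "0 \<le> x" "x \<le> 1" for x :: real
        using that by (cases "x = 0") (auto simp: ln_div intro!: mult_nonneg_nonneg mult_nonneg_nonpos)
    qed (auto intro!: continuous_intros)
    show ?thesis
      unfolding law[OF distr[OF d]]
      by (rule not_tempered_of_log_density[where c = 4 and n = 2]) auto
  qed
  ultimately show ?thesis
    by auto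
qed

end
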